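(* Let $\alpha,\mu$ be real numbers with $0<\mu\le 1$ and $\alpha+\mu\ge 0$, and let $\beta,\gamma,\delta$ be complex numbers with $\beta\neq 0$. Let $q_i\in\mathcal{R}(\alpha,\beta,\gamma,\delta,\mu)$ $(i=1,2)$ be analytic and univalent in $\mathbb{D}$. Set $$R_i(z):=\frac{zq_i'(z)}{\beta q_i(z)+\gamma},\qquad h_i(z):=(q_i(z))^\alpha\left(q_i(z)+\delta+\frac{zq_i'(z)}{\beta q_i(z)+\gamma}\right)^\mu\quad(i=1,2;\ z\in\mathbb{D}).$$ Assume that $$\operatorname{Re}\left((\beta q_i(z)+\gamma)\left(1+\frac{\alpha}{\mu}+\frac{\alpha\delta}{\mu q_i(z)}\right)\right)>0\quad(i=1,2;\ z\in\mathbb{D})$$ and $$\operatorname{Re}\left(\frac{\alpha}{\mu}\frac{zq_i'(z)}{q_i(z)}+\frac{zR_i'(z)}{R_i(z)}\right)>0\quad(i=1,2;\ z\in\mathbb{D}).$$ If $p\in\mathcal{R}(\alpha,\beta,\gamma,\delta,\mu)$ satisfies $p\in\mathcal{H}\cap\mathcal{Q}$ and $$(p(z))^{\frac{\alpha}{\mu}+1}+\delta(p(z))^{\frac{\alpha}{\mu}}+(p(z))^{\frac{\alpha}{\mu}}\frac{zp'(z)}{\beta p(z)+\gamma}$$ is univalent in $\mathbb{D}$, then $$h_1(z)\prec(p(z))^\alpha\left(p(z)+\delta+\frac{zp'(z)}{\beta p(z)+\gamma}\right)^\mu\prec h_2(z)$$ implies $q_1(z)\prec p(z)\prec q_2(z)$.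 Further, $q_1$ and $q_2$ are respectively the best subordinant (of the left-hand superordination) and the best dominant (of the right-hand subordination).
   Context: $\mathbb{D}=\{z\in\mathbb{C}:|z|<1\}$; $\mathcal{H}$ is the class of analytic functions in $\mathbb{D}$. Univalent means analytic and injective. For $f,g\in\mathcal{H}$, $f\prec g$ ($f$ is subordinate to $g$) means there is an analytic $w:\mathbb{D}\to\mathbb{D}$ with $w(0)=0$ and $f(z)=g(w(z))$ for all $z\in\mathbb{D}$. $\mathcal{Q}$ is the set of all functions $f$ that are analytic and injective on $\overline{\mathbb{D}}\setminus E(f)$, where $E(f)=\{\zeta\in\partial\mathbb{D}:\lim_{z\to\zeta}f(z)=\infty\}$, and are such that $f'(\zeta)\ne 0$ for $\zeta\in\partial\mathbb{D}\setminus E(f)$. The class $\mathcal{R}(\alpha,\beta,\gamma,\delta,\mu)$ consists of the analytic functions $p$ in $\mathbb{D}$ with $p(0)=1$, $p(z)\ne 0$ in $\mathbb{D}$, such that $P(z):=(p(z))^\alpha\left(p(z)+\delta+\frac{zp'(z)}{\beta p(z)+\gamma}\right)^\mu$ is well-defined in $\mathbb{D}$, the powers being principal values; that is, $\beta p(z)+\gamma$ has no zeros in $\mathbb{D}$ and the two principal powers appearing in $P$ are analytic functions in $\mathbb{D}$. The functions $zR_i'(z)/R_i(z)$ are understood at $z=0$ by their removable-singularity values. Best dominant: a univalent function $\tilde q$ is a dominant of the subordination $P\prec h_2$ if $p\prec\tilde q$ for every $p\in\mathcal{R}(\alpha,\beta,\gamma,\delta,\mu)$ satisfying it; the best dominant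 is a dominant $q$ such that $q\prec\tilde q$ for every dominant $\tilde q$. Best subordinant: a solution of the superordination $h_1\prec P$ is a univalent $p\in\mathcal{R}(\alpha,\beta,\gamma,\delta,\mu)$ satisfying it for which $(p(z))^{\frac{\alpha}{\mu}+1}+\delta(p(z))^{\frac{\alpha}{\mu}}+(p(z))^{\frac{\alpha}{\mu}}\frac{zp'(z)}{\beta p(z)+\gamma}$ is univalent. An analytic function $\tilde q$ is a subordinant if $\tilde q\prec p$ for every solution $p$; the best subordinant is a univalent subordinant $q$ such that $\tilde q\prec q$ for every subordinant $\tilde q$. *)

theory Defs
  imports "HOL-Complex_Analysis.Complex_Analysis"
begin

abbreviation unit_disc :: "complex set" ("\<DD>")
  where "\<DD> \<equiv> ball 0 1"

definition univalent :: "(complex \<Rightarrow> complex) \<Rightarrow> bool"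
  where "univalent f \<longleftrightarrow> f holomorphic_on \<DD> \<and> inj_on f \<DD>"

definition subordinate :: "(complex \<Rightarrow> complex) \<Rightarrow> (complex \<Rightarrow> complex) \<Rightarrow> bool"  (infix "\<prec>" 50)
  where "f \<prec> g \<longleftrightarrow> f holomorphic_on \<DD> \<and> g holomorphic_on \<DD> \<and>
     (\<exists>w. w holomorphic_on \<DD> \<and> w ` \<DD> \<subseteq> \<DD> \<and> w 0 = 0 \<and> (\<forall>z\<in>\<DD>. f z = g (w z)))"

definition exceptional_set :: "(complex \<Rightarrow> complex) \<Rightarrow> complex set"
  where "exceptional_set f = {\<zeta> \<in> sphere 0 1. filterlim f at_infinity (at \<zeta> within \<DD>)}"

(* A function on the disc is identified with its analytic continuation across the boundary:
   \<open>analytic_on\<close> asks for holomorphy in a neighbourhood of every point of the set.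
   The values of f on the exceptional set are irrelevant. *)
definition class_Q :: "(complex \<Rightarrow> complex) set"
  where "class_Q = {f. f analytic_on (cball 0 1 - exceptional_set f) \<and>
     inj_on f (cball 0 1 - exceptional_set f) \<and>
     (\<forall>\<zeta> \<in> sphere 0 1 - exceptional_set f. deriv f \<zeta> \<noteq> 0)}"

definition R_fun :: "complex \<Rightarrow> complex \<Rightarrow> (complex \<Rightarrow> complex) \<Rightarrow> complex \<Rightarrow> complex"
  where "R_fun \<beta> \<gamma> p z = z * deriv p z / (\<beta> * p z + \<gamma>)"

definition P_fun :: "real \<Rightarrow> complex \<Rightarrow> complex \<Rightarrow> complex \<Rightarrow> real \<Rightarrow> (complex \<Rightarrow> complex) \<Rightarrow> complex \<Rightarrow> complex"
  where "P_fun \<alpha> \<beta> \<gamma> \<delta> \<mu> p z =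
     p z powr of_real \<alpha> * (p z + \<delta> + z * deriv p z / (\<beta> * p z + \<gamma>)) powr of_real \<mu>"

(* For complex arguments \<open>powr\<close> is the principal power, with \<open>0 powr a = 0\<close>; the latter is the
   right value of the second power since it is only used with a positive exponent. *)
definition class_R :: "real \<Rightarrow> complex \<Rightarrow> complex \<Rightarrow> complex \<Rightarrow> real \<Rightarrow> (complex \<Rightarrow> complex) set"
  where "class_R \<alpha> \<beta> \<gamma> \<delta> \<mu> = {p. p holomorphic_on \<DD> \<and> p 0 = 1 \<and>
     (\<forall>z\<in>\<DD>. p z \<noteq> 0) \<and> (\<forall>z\<in>\<DD>. \<beta> * p z + \<gamma> \<noteq> 0) \<and>
     (\<lambda>z. p z powr of_real \<alpha>) holomorphic_on \<DD> \<and>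
     (\<lambda>z. (p z + \<delta> + z * deriv p z / (\<beta> * p z + \<gamma>)) powr of_real \<mu>) holomorphic_on \<DD>}"

(* The analytic branch of log p on the disc with value 0 at 0, for a zero-free analytic p with
   p(0) = 1, and the corresponding powers of p. It exists (\<open>disc_log\<close>), it determines the powers
   uniquely, and such a power is the principal one as soon as the principal one is analytic
   (\<open>disc_power_eq_powr\<close>). *)
definition disc_log :: "(complex \<Rightarrow> complex) \<Rightarrow> complex \<Rightarrow> complex"
  where "disc_log p = (SOME L. L holomorphic_on \<DD> \<and> L 0 = 0 \<and> (\<forall>z\<in>\<DD>. exp (L z) = p z))"

definition disc_power :: "(complex \<Rightarrow> complex) \<Rightarrow> complex \<Rightarrow> complex \<Rightarrow> complex"
  where "disc_power p c z = exp (c * disc_log p z)"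

lemma disc_log:
  assumes "p holomorphic_on \<DD>" "p 0 = 1" "\<And>z. z \<in> \<DD> \<Longrightarrow> p z \<noteq> 0"
  shows "disc_log p holomorphic_on \<DD>" "disc_log p 0 = 0"
    and "\<And>z. z \<in> \<DD> \<Longrightarrow> exp (disc_log p z) = p z"
proof -
  obtain g where g: "g holomorphic_on \<DD>" "\<And>z. z \<in> \<DD> \<Longrightarrow> exp (g z) = p z"
    using holomorphic_logarithm_exists[of \<DD> p 0] assms by auto
  have "exp (g 0) = 1" using g(2)[of 0] assms(2) by simp
  then have "(\<lambda>z. g z - g 0) holomorphic_on \<DD> \<and> g 0 - g 0 = 0 \<and> (\<forall>z\<in>\<DD>. exp (g z - g 0) = p z)"
    using g by (auto simp: exp_diff intro!: holomorphic_intros)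
  then have "disc_log p holomorphic_on \<DD> \<and> disc_log p 0 = 0 \<and> (\<forall>z\<in>\<DD>. exp (disc_log p z) = p z)"
    unfolding disc_log_def
    by (rule someI[of "\<lambda>L. L holomorphic_on \<DD> \<and> L 0 = 0 \<and> (\<forall>z\<in>\<DD>. exp (L z) = p z)"])
  then show "disc_log p holomorphic_on \<DD>" "disc_log p 0 = 0"
    and "\<And>z. z \<in> \<DD> \<Longrightarrow> exp (disc_log p z) = p z" by auto
qed

lemma disc_power_eq_powr:
  assumes p: "p holomorphic_on \<DD>" "p 0 = 1" "\<And>z. z \<in> \<DD> \<Longrightarrow> p z \<noteq> 0"
    and c: "(\<lambda>z. p z powr c) holomorphic_on \<DD>" and z: "z \<in> \<DD>"
  shows "disc_power p c z = p z powr c"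
proof -
  have L: "disc_log p holomorphic_on \<DD>" "disc_log p 0 = 0" "\<And>x. x \<in> \<DD> \<Longrightarrow> exp (disc_log p x) = p x"
    using disc_log[of p] p by auto
  have "continuous_on \<DD> (disc_log p)" by (rule holomorphic_on_imp_continuous_on[OF L(1)])
  then have "isCont (disc_log p) 0" by (simp add: continuous_on_eq_continuous_at)
  then obtain d where d: "d > 0" "\<And>x. dist x 0 < d \<Longrightarrow> dist (disc_log p x) (disc_log p 0) < 1"
    unfolding continuous_at by (metis continuous_at_eps_delta continuous_at zero_less_one)
  define S where "S = ball (0::complex) (min d 1)"
  have eq: "disc_power p c x = p x powr c" if "x \<in> S" for x
  proof -
    have x: "x \<in> \<DD>" "norm x < d" using that by (auto simp: S_def)
    then have "norm (disc_log p x) < 1" using d(2)[of x] L(2) by simp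
    then have "\<bar>Im (disc_log p x)\<bar> < 1" using abs_Im_le_cmod order_le_less_trans by blast
    then have "Ln (exp (disc_log p x)) = disc_log p x"
      using pi_gt3 by (intro Ln_exp) auto
    then have "Ln (p x) = disc_log p x" using L(3)[OF x(1)] by simp
    then show ?thesis using p(3)[OF x(1)] by (simp add: disc_power_def powr_def)
  qed
  have hol: "(disc_power p c) holomorphic_on \<DD>"
    unfolding disc_power_def by (intro holomorphic_intros L)
  show ?thesis
    by (rule analytic_continuation_open[of S \<DD>]) (use d eq hol c z in \<open>auto simp: S_def\<close>)
qed

(* The powers are the analytic branches with value 1 at 0. For p in class_R the principal power
   with exponent \<alpha>/\<mu> need not be analytic (\<alpha> = 1, \<mu> = 2/3, p taking negative values); whenever it
   is, disc_power is that principal power. *)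
definition S_fun :: "real \<Rightarrow> complex \<Rightarrow> complex \<Rightarrow> complex \<Rightarrow> real \<Rightarrow> (complex \<Rightarrow> complex) \<Rightarrow> complex \<Rightarrow> complex"
  where "S_fun \<alpha> \<beta> \<gamma> \<delta> \<mu> p z =
     disc_power p (of_real (\<alpha> / \<mu> + 1)) z + \<delta> * disc_power p (of_real (\<alpha> / \<mu>)) z
       + disc_power p (of_real (\<alpha> / \<mu>)) z * (z * deriv p z / (\<beta> * p z + \<gamma>))"

definition dominant where
  "dominant \<alpha> \<beta> \<gamma> \<delta> \<mu> h q \<longleftrightarrow> univalent q \<and>
     (\<forall>p \<in> class_R \<alpha> \<beta> \<gamma> \<delta> \<mu>. P_fun \<alpha> \<beta> \<gamma> \<delta> \<mu> p \<prec> h \<longrightarrow> p \<prec> q)"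

definition best_dominant where
  "best_dominant \<alpha> \<beta> \<gamma> \<delta> \<mu> h q \<longleftrightarrow> dominant \<alpha> \<beta> \<gamma> \<delta> \<mu> h q \<and>
     (\<forall>q'. dominant \<alpha> \<beta> \<gamma> \<delta> \<mu> h q' \<longrightarrow> q \<prec> q')"

definition superordination_solution where
  "superordination_solution \<alpha> \<beta> \<gamma> \<delta> \<mu> h p \<longleftrightarrow> p \<in> class_R \<alpha> \<beta> \<gamma> \<delta> \<mu> \<and> univalent p \<and>
     h \<prec> P_fun \<alpha> \<beta> \<gamma> \<delta> \<mu> p \<and> univalent (S_fun \<alpha> \<beta> \<gamma> \<delta> \<mu> p)"

definition subordinant where
  "subordinant \<alpha> \<beta> \<gamma> \<delta> \<mu> h q \<longleftrightarrow> q holomorphic_on \<DD> \<and>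
     (\<forall>p. superordination_solution \<alpha> \<beta> \<gamma> \<delta> \<mu> h p \<longrightarrow> q \<prec> p)"

definition best_subordinant where
  "best_subordinant \<alpha> \<beta> \<gamma> \<delta> \<mu> h q \<longleftrightarrow> univalent q \<and> subordinant \<alpha> \<beta> \<gamma> \<delta> \<mu> h q \<and>
     (\<forall>q'. subordinant \<alpha> \<beta> \<gamma> \<delta> \<mu> h q' \<longrightarrow> q' \<prec> q)"

end

theory Submission
  imports Defs
begin

text \<open>
  Write \<open>h = G + z k\<close> for the function \<open>S_fun\<close> of \<open>q\<close>, where \<open>G = q\<^sup>a\<^sup>+\<^sup>1 + \<delta> q\<^sup>a\<close>, \<open>k = q\<^sup>a q' / (\<beta> q + \<gamma>)\<close> and
  \<open>a = \<alpha> / \<mu>\<close>. The two hypotheses on \<open>q\<close> say that \<open>G' / k\<close> has positive real part and that \<open>z k\<close> is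
  starlike. Hence a primitive of \<open>k\<close> is convex, and each \<open>G + s z k\<close> with \<open>s \<ge> 0\<close> is close-to-convex: the
  ray from a boundary point \<open>u\<close> of the image of a disc in direction \<open>u k(u)\<close> never meets that image
  again.

  If \<open>p\<close> is not subordinate to \<open>q\<close>, take a first point \<open>z\<close> at which \<open>p\<close> leaves the image under \<open>q\<close> of a
  disc, say \<open>p(z) = q(u)\<close> with \<open>\<bar>z\<bar> < \<bar>u\<bar>\<close>. Jack's lemma gives \<open>z p'(z) = m u q'(u)\<close> with \<open>m \<ge> 1\<close>, so
  \<open>S_fun\<close> of \<open>p\<close> at \<open>z\<close> lies on the ray leaving \<open>h(u)\<close>, while the subordination puts it into the image
  under \<open>h\<close> of the disc of radius \<open>\<bar>z\<bar>\<close>. For the superordination the roles are exchanged: \<open>1 / m \<le> 1\<close> and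
  the images of a disc under \<open>G + s z k\<close> grow with \<open>s\<close>, which contradicts the univalence of \<open>S_fun\<close> of \<open>p\<close>.
\<close>

section \<open>Branches of the logarithm\<close>

text \<open>Two logarithms of the same function differ by integer multiples of
  \<open>2 * pi * \<i>\<close>. Distinct values of the difference are thus at least
  \<open>2 * pi\<close> apart, and a continuous function with such values is constant on a connected
  set.\<close>

lemma exp_eq_on_connected:
  fixes f g :: "'a::topological_space \<Rightarrow> complex"
  assumes S: "connected S" and f: "continuous_on S f" and g: "continuous_on S g"
    and eq: "\<And>x. x \<in> S \<Longrightarrow> exp (f x) = exp (g x)"
    and a: "a \<in> S" "f a = g a" and x: "x \<in> S"
  shows "f x = g x"
proof -
  have "(\<lambda>x. f x - g x) constant_on S"
  proof (rule continuous_discrete_range_constant[OF S])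
    show "continuous_on S (\<lambda>x. f x - g x)" by (intro continuous_intros f g)
    fix x assume x: "x \<in> S"
    show "\<exists>e>0. \<forall>y. y \<in> S \<and> f y - g y \<noteq> f x - g x \<longrightarrow> e \<le> norm (f y - g y - (f x - g x))"
    proof (intro exI[of _ "2 * pi"] conjI allI impI)
      show "0 < 2 * pi" by simp
      fix y assume y: "y \<in> S \<and> f y - g y \<noteq> f x - g x"
      obtain m where m: "f x = g x + (of_int (2 * m) * pi) * \<i>"
        using eq[OF x] unfolding exp_eq by auto
      obtain n where n: "f y = g y + (of_int (2 * n) * pi) * \<i>"
        using eq[of y] y unfolding exp_eq by auto
      have d: "f y - g y - (f x - g x) = of_real (2 * pi * of_int (n - m)) * \<i>"
        using m n by (simp add: algebra_simps)
      have "n \<noteq> m" using d y by auto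
      then have "1 \<le> \<bar>of_int (n - m) :: real\<bar>" by linarith
      then have "2 * pi * 1 \<le> 2 * pi * \<bar>of_int (n - m) :: real\<bar>"
        by (intro mult_left_mono) auto
      then show "2 * pi \<le> norm (f y - g y - (f x - g x))"
        unfolding d by (simp only: norm_mult norm_of_real abs_mult) (simp add: abs_mult)
    qed
  qed
  then obtain c where "\<And>y. y \<in> S \<Longrightarrow> f y - g y = c" by (auto simp: constant_on_def)
  from this[OF a(1)] this[OF x] show ?thesis using a(2) by simp
qed

lemma deriv_logarithm:
  assumes S: "open S" and l: "l holomorphic_on S" "\<And>z. z \<in> S \<Longrightarrow> exp (l z) = f z" and z: "z \<in> S"
  shows "deriv l z = deriv f z / f z"
proof -
  have "((\<lambda>z. exp (l z)) has_field_derivative exp (l z) * deriv l z) (at z)"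
    using DERIV_fun_exp[OF holomorphic_derivI[OF l(1) S z]] by simp
  then have "(f has_field_derivative exp (l z) * deriv l z) (at z)"
    by (rule has_field_derivative_transform_within_open[OF _ S z]) (use l(2) in auto)
  then have "deriv f z = f z * deriv l z" using l(2)[OF z] DERIV_imp_deriv by auto
  moreover have "f z \<noteq> 0" using l(2)[OF z] by (metis exp_not_eq_zero)
  ultimately show ?thesis by (simp add: field_simps)
qed

section \<open>Starlike, convex and close-to-convex functions\<close>

text \<open>Along the circle the argument of \<open>z * k z\<close> is strictly increasing, and its total increase is
  exactly \<open>2 * pi\<close> because \<open>k\<close> has a logarithm.\<close>
lemma starlike_arg_inj_on_circle:
  assumes k: "k holomorphic_on \<DD>" "\<And>z. z \<in> \<DD> \<Longrightarrow> k z \<noteq> 0"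
    and st: "\<And>z. z \<in> \<DD> \<Longrightarrow> Re (1 + z * deriv k z / k z) > 0"
    and z: "norm z = norm u" and u: "u \<in> \<DD>" "u \<noteq> 0"
    and c: "z * k z = of_real c * (u * k u)" "c > 0"
  shows "z = u"
proof (rule ccontr)
  assume "z \<noteq> u"
  obtain l where l: "l holomorphic_on \<DD>" "\<And>z. z \<in> \<DD> \<Longrightarrow> exp (l z) = k z"
    using holomorphic_logarithm_exists[of \<DD> k 0] k by auto
  obtain \<phi> where \<phi>: "0 \<le> \<phi>" "\<phi> < 2 * pi" "z / u = exp (\<i> * of_real \<phi>)"
  proof -
    have "norm (z / u) = 1" using z u by (simp add: norm_divide)
    then show thesis using complex_unimodular_polar[of "z / u"] that
      by (metis cis_conv_exp complex_norm_eq_1_exp exp_Euler cis.ctr Arg2pi_ge_0 Arg2pi_lt_2pi complex_norm_eq_1_exp mult.commute)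
  qed
  have zu: "z = u * exp (\<i> * of_real \<phi>)" using \<phi>(3) u by (simp add: field_simps)
  have "\<phi> > 0" using zu \<open>z \<noteq> u\<close> \<phi>(1) by (cases "\<phi> = 0") auto
  \<comment> \<open>\<open>g t\<close> is a continuous lift of the argument of
    \<open>x * k x\<close> at \<open>x = u * exp (\<i> * t)\<close>, normalized to be 0 at
    \<open>t = 0\<close>; its derivative is the real part assumed positive in
    \<open>st\<close>.\<close>
  define g where "g = (\<lambda>t::real. t + Im (l (u * exp (\<i> * of_real t))) - Im (l u))"
  have inD: "u * exp (\<i> * of_real t) \<in> \<DD>" for t :: real
    using u by (simp add: norm_mult)
  have g': "\<exists>y. DERIV g t :> y \<and> y > 0" for t
  proof -
    let ?x = "u * exp (\<i> * of_real t)"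
    have dl: "(l has_field_derivative deriv l ?x) (at ?x)"
      using holomorphic_derivI[OF l(1)] inD by simp
    have dk: "deriv l ?x = deriv k ?x / k ?x"
      by (rule deriv_logarithm[OF open_ball l(1) _ inD]) (use l in auto)
    have "((\<lambda>s. l (u * exp (\<i> * s))) has_field_derivative deriv l ?x * (u * (exp (\<i> * of_real t) * \<i>))) (at (of_real t))"
      by (rule DERIV_chain2[where f = l and g = "\<lambda>s. u * exp (\<i> * s)", OF dl]) (auto intro!: derivative_eq_intros)
    then have "((\<lambda>s. l (u * exp (\<i> * of_real s))) has_vector_derivative deriv l ?x * (u * (exp (\<i> * of_real t) * \<i>))) (at t)"
      using has_vector_derivative_real_field by blast
    from has_field_derivative_Im[OF this]
    have "((\<lambda>s. Im (l (u * exp (\<i> * of_real s)))) has_real_derivative Im (deriv l ?x * (u * (exp (\<i> * of_real t) * \<i>)))) (at t)" .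
    then have "DERIV g t :> 1 + Im (deriv l ?x * (u * (exp (\<i> * of_real t) * \<i>))) - 0"
      unfolding g_def by (intro DERIV_diff DERIV_add DERIV_ident DERIV_const)
    moreover have "deriv l ?x * (u * (exp (\<i> * of_real t) * \<i>)) = (?x * deriv k ?x / k ?x) * \<i>"
      unfolding dk by simp
    ultimately have "DERIV g t :> Re (1 + ?x * deriv k ?x / k ?x)"
      by (simp only: Im_i_times mult.commute[of _ \<i>] plus_complex.sel one_complex.sel diff_0_right)
    then show ?thesis using st[OF inD] by blast
  qed
  have g0: "g 0 = 0" by (simp add: g_def)
  have g2: "g (2 * pi) = 2 * pi" by (simp add: g_def exp_two_pi_i mult.commute)
  have "g 0 < g \<phi>" by (rule DERIV_pos_imp_increasing[OF \<open>\<phi> > 0\<close>]) (use g' in auto)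
  moreover have "g \<phi> < g (2 * pi)" by (rule DERIV_pos_imp_increasing[OF \<open>\<phi> < 2 * pi\<close>]) (use g' in auto)
  ultimately have gb: "0 < g \<phi>" "g \<phi> < 2 * pi" using g0 g2 by auto
  have zD: "z \<in> \<DD>" using z u by simp
  have "exp (\<i> * of_real \<phi> + l z - l u) = of_real c"
    using c(1) zu u k(2)[OF u(1)] l(2)[OF u(1)] l(2)[OF zD] by (simp add: exp_add exp_diff field_simps)
  moreover have "exp (\<i> * of_real \<phi> + l z - l u) = of_real (exp (Re (l z) - Re (l u))) * cis (g \<phi>)"
    by (simp add: exp_eq_polar g_def zu)
  ultimately have e: "of_real (exp (Re (l z) - Re (l u))) * cis (g \<phi>) = of_real c" by simp
  then have "norm (of_real (exp (Re (l z) - Re (l u))) * cis (g \<phi>)) = c" using c(2) by simp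
  then have "exp (Re (l z) - Re (l u)) = c" by (simp add: norm_mult)
  \<comment> \<open>The positive ratio \<open>c\<close> forces \<open>g \<phi>\<close> to be a
    multiple of \<open>2 * pi\<close>, although it lies strictly between 0 and
    \<open>2 * pi\<close>.\<close>
  then have "cis (g \<phi>) = 1" using e c(2) by auto
  then have "cos (g \<phi>) = 1" by (metis cis.sel(1) one_complex.sel(1))
  then obtain n :: int where n: "g \<phi> = of_int n * 2 * pi" using cos_one_2pi_int by auto
  have "0 < n" using gb n by (simp add: zero_less_mult_iff)
  moreover have "n < 1" using gb n by simp
  ultimately show False by linarith
qed

text \<open>At a maximum point \<open>x\<close> of \<open>Re (K / (u * k u))\<close> on the closed disc the tangential derivative
  vanishes and the radial one is nonnegative, so \<open>x * k x\<close> is a positive multiple of \<open>u * k u\<close>.\<close>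
lemma convex_support:
  assumes k: "k holomorphic_on \<DD>" "\<And>z. z \<in> \<DD> \<Longrightarrow> k z \<noteq> 0"
    and st: "\<And>z. z \<in> \<DD> \<Longrightarrow> Re (1 + z * deriv k z / k z) > 0"
    and K: "\<And>z. z \<in> \<DD> \<Longrightarrow> (K has_field_derivative k z) (at z)"
    and u: "u \<in> \<DD>" "u \<noteq> 0" and z: "norm z \<le> norm u" "z \<noteq> u"
  shows "Re ((K u - K z) / (u * k u)) > 0"
proof -
  define n where "n = u * k u"
  define f where "f = (\<lambda>z. K z / n)"
  have n0: "n \<noteq> 0" using u k by (simp add: n_def)
  have sub: "cball 0 (norm u) \<subseteq> \<DD>" using u by auto
  have f': "(f has_field_derivative k z / n) (at z)" if "z \<in> \<DD>" for z
    unfolding f_def by (rule DERIV_cdivide[OF K[OF that]])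
  have cont: "continuous_on (cball 0 (norm u)) (\<lambda>z. Re (f z))"
    by (intro continuous_intros continuous_at_imp_continuous_on ballI DERIV_isCont[OF f'])
      (use sub in auto)
  \<comment> \<open>Once \<open>u\<close> is the only possible maximum point, compactness makes it
    the maximum, and the inequality at any other \<open>z\<close> is strict.\<close>
  have max: "x = u" if x: "x \<in> cball 0 (norm u)" and m: "\<And>y. y \<in> cball 0 (norm u) \<Longrightarrow> Re (f y) \<le> Re (f x)" for x
  proof -
    have xD: "x \<in> \<DD>" using x sub by auto
    have path: "((\<lambda>t. Re (f (\<gamma> t))) has_real_derivative Re (k x / n * d)) (at 0)"
      if "(\<gamma> has_vector_derivative d) (at 0)" "\<gamma> 0 = x" for \<gamma> :: "real \<Rightarrow> complex" and d
      using has_field_derivative_Re[OF field_vector_diff_chain_at[OF that(1), of f "k x / n"]] f'[OF xD] that(2)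
      by (simp add: o_def mult.commute)
    show ?thesis
    proof (cases "norm x < norm u")
      case True
      \<comment> \<open>The gradient direction of \<open>Re f\<close>: moving along it from an
        interior point increases \<open>Re f\<close>.\<close>
      define d where "d = cnj (k x / n)"
      have "k x / n \<noteq> 0" using k(2)[OF xD] n0 by simp
      then have "Re (k x / n * d) > 0"
        unfolding d_def complex_norm_square[symmetric] by (simp del: of_real_power divide_eq_0_iff)
      moreover have "((\<lambda>t. x + of_real t * d) has_vector_derivative d) (at 0)"
        by (auto intro!: derivative_eq_intros)
      ultimately obtain e where e: "e > 0" "\<And>h. h > 0 \<Longrightarrow> h < e \<Longrightarrow> Re (f x) < Re (f (x + of_real h * d))"
        using DERIV_pos_inc_right[OF path[of "\<lambda>t. x + of_real t * d" d]] by auto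
      have "((\<lambda>t. norm (x + of_real t * d)) \<longlongrightarrow> norm (x + of_real 0 * d)) (at_right 0)"
        by (intro tendsto_intros)
      then have "\<forall>\<^sub>F t in at_right 0. norm (x + of_real t * d) < norm u"
        using True by (intro order_tendstoD(2)) auto
      moreover have "\<forall>\<^sub>F t in at_right 0. t \<in> {0<..<e}"
        using e(1) eventually_at_right_real by blast
      ultimately have "\<forall>\<^sub>F t in at_right (0::real). False"
      proof eventually_elim
        case (elim t)
        then show ?case using e(2)[of t] m[of "x + of_real t * d"] by auto
      qed
      then show ?thesis by simp
    next
      case False
      then have nx: "norm x = norm u" using x by auto
      \<comment> \<open>At a point of the circle the radial derivative of \<open>Re f\<close> is
        \<open>Re c\<close> and the tangential one is \<open>- Im c\<close>.\<close>
      define c where "c = x * k x / n"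
      have "((\<lambda>t. x * cis t) has_vector_derivative x * \<i>) (at 0)"
        by (auto simp: has_vector_derivative_complex_iff intro!: derivative_eq_intros)
      from path[OF this] have "Re (k x / n * (x * \<i>)) = 0"
        by (rule DERIV_local_max[of _ _ 0 1]) (use m nx in \<open>auto simp: norm_mult\<close>)
      moreover have "k x / n * (x * \<i>) = c * \<i>" by (simp add: c_def)
      ultimately have im: "Im c = 0" by simp
      have re: "Re c \<ge> 0"
      proof (rule ccontr)
        assume "\<not> Re c \<ge> 0"
        then have "Re (k x / n * (- x)) > 0" by (simp add: c_def mult.commute)
        moreover have "((\<lambda>t. x + of_real t * (- x)) has_vector_derivative - x) (at 0)"
          by (auto intro!: derivative_eq_intros)
        ultimately obtain e where e: "e > 0" "\<And>h. h > 0 \<Longrightarrow> h < e \<Longrightarrow> Re (f x) < Re (f (x + of_real h * (- x)))"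
          using DERIV_pos_inc_right[OF path[of "\<lambda>t. x + of_real t * (- x)" "- x"]] by auto
        define h where "h = min (e / 2) 1"
        have h: "h > 0" "h < e" "h \<le> 1" using e(1) by (auto simp: h_def)
        have "norm (x + of_real h * (- x)) = norm (of_real (1 - h) * x)" by (simp add: algebra_simps)
        also have "\<dots> \<le> norm x" using h by (simp add: norm_mult mult_left_le_one_le del: of_real_diff)
        finally show False using e(2)[OF h(1,2)] m[of "x + of_real h * (- x)"] nx by auto
      qed
      have "c \<noteq> 0" using nx u k(2)[OF xD] n0 by (auto simp: c_def)
      then have "Re c > 0" using re im by (auto simp: complex_eq_iff)
      moreover have "x * k x = of_real (Re c) * (u * k u)"
      proof -
        have "c = of_real (Re c)" using im by (simp add: complex_eq_iff)
        then show ?thesis using n0 unfolding c_def n_def[symmetric] by (metis nonzero_divide_eq_eq)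
      qed
      ultimately show ?thesis using starlike_arg_inj_on_circle[OF k st nx u] by blast
    qed
  qed
  obtain x where x: "x \<in> cball 0 (norm u)" "\<And>y. y \<in> cball 0 (norm u) \<Longrightarrow> Re (f y) \<le> Re (f x)"
    using continuous_attains_sup[OF compact_cball _ cont] by auto
  have "x = u" using max[OF x] .
  have le: "Re (f y) \<le> Re (f u)" if "y \<in> cball 0 (norm u)" for y using x(2)[OF that] \<open>x = u\<close> by simp
  have "Re (f z) \<noteq> Re (f u)" using max[of z] le z by force
  then have "Re (f z) < Re (f u)" using le[of z] z by simp
  then show ?thesis by (simp add: f_def n_def diff_divide_distrib)
qed

text \<open>By \<open>convex_support\<close>, the image of each circle about 0 has at every point a
  supporting line, which the image of the closed disc touches only there. A segment with endpoints
  in the image of a smaller disc cannot leave that image: at a frontier point both endpoints would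
  lie strictly on the same side of the supporting line.\<close>

lemma convex_function_convex_image:
  assumes k: "k holomorphic_on \<DD>" "\<And>z. z \<in> \<DD> \<Longrightarrow> k z \<noteq> 0"
    and st: "\<And>z. z \<in> \<DD> \<Longrightarrow> Re (1 + z * deriv k z / k z) > 0"
    and K: "\<And>z. z \<in> \<DD> \<Longrightarrow> (K has_field_derivative k z) (at z)"
  shows "inj_on K \<DD>" "convex (K ` \<DD>)"
proof -
  have supp: "Re ((K u - K z) / (u * k u)) > 0"
    if "u \<in> \<DD>" "u \<noteq> 0" "norm z \<le> norm u" "z \<noteq> u" for u z
    by (rule convex_support) (use k st K that in auto)
  have *: "x = y" if "x \<in> \<DD>" "y \<in> \<DD>" "K x = K y" "norm x \<le> norm y" for x y
    using supp[of y x] that by (cases "y = 0") auto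
  show inj: "inj_on K \<DD>"
    by (rule inj_onI) (metis * linear)
  have holK: "K holomorphic_on \<DD>" by (rule holomorphic_onI) (use K field_differentiable_at_within field_differentiable_def in blast)
  show "convex (K ` \<DD>)"
  proof (rule convexI, goal_cases)
    case (1 a b s t)
    then obtain x y where xy: "x \<in> \<DD>" "y \<in> \<DD>" "a = K x" "b = K y" by auto
    \<comment> \<open>A closed disc inside \<open>\<DD>\<close> has compact image, so frontier
      points of \<open>U\<close> are values of \<open>K\<close> on the circle of radius
      \<open>r\<close>.\<close>
    obtain r where r: "max (norm x) (norm y) < r" "r < 1" using xy dense[of "max (norm x) (norm y)" 1] by auto
    have r0: "r > 0" using r norm_ge_zero[of x] by linarith
    define U where "U = K ` ball 0 r"
    have bD: "cball 0 r \<subseteq> \<DD>" using r by auto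
    have "closed_segment a b \<subseteq> U"
    proof (rule ccontr)
      assume "\<not> ?thesis"
      then have "closed_segment a b - U \<noteq> {}" by auto
      moreover have "a \<in> closed_segment a b \<inter> U" using xy r by (auto simp: U_def)
      ultimately obtain c where c: "c \<in> closed_segment a b" "c \<in> frontier U"
        using connected_Int_frontier[OF connected_segment(1)[of a b], of U] by blast
      have "compact (K ` cball 0 r)"
        by (intro compact_continuous_image holomorphic_on_imp_continuous_on holomorphic_on_subset[OF holK] bD compact_cball)
      then have "closure U \<subseteq> K ` cball 0 r"
        by (intro closure_minimal compact_imp_closed) (auto simp: U_def)
      moreover have "open U" unfolding U_def
        by (rule open_mapping_thm3) (use holomorphic_on_subset[OF holK, of "ball 0 r"] inj_on_subset[OF inj, of "ball 0 r"] order_trans[OF ball_subset_cball bD] in auto)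
      ultimately obtain u where u: "c = K u" "norm u \<le> r" "c \<notin> U"
        using c(2) by (auto simp: frontier_def interior_open)
      then have ur: "norm u = r" by (force simp: U_def)
      have uD: "u \<in> \<DD>" "u \<noteq> 0" using ur r r0 by auto
      obtain v where v: "c = (1 - v) *\<^sub>R a + v *\<^sub>R b" "0 \<le> v" "v \<le> 1" using c(1) by (auto simp: in_segment)
      \<comment> \<open>Up to a common positive factor, the distances of \<open>a\<close> and
        \<open>b\<close> from the supporting line at \<open>c\<close>. Their weighted mean vanishes
        because \<open>c\<close> lies on the segment.\<close>
      define X Y where "X = Re ((K u - K x) / (u * k u))" and "Y = Re ((K u - K y) / (u * k u))"
      have "X > 0" "Y > 0" using supp[OF uD, of x] supp[OF uD, of y] r ur unfolding X_def Y_def by auto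
      moreover have "(1 - v) * X + v * Y = 0"
      proof -
        have lin: "Re ((r *\<^sub>R w) / n) = r * Re (w / n)" for r :: real and w n :: complex
          by (simp add: divide_inverse right_diff_distrib mult.assoc)
        have "(1 - v) * X + v * Y = Re (((1 - v) *\<^sub>R (c - a) + v *\<^sub>R (c - b)) / (u * k u))"
          by (simp add: X_def Y_def u(1)[symmetric] xy(3,4)[symmetric] add_divide_distrib lin)
        also have "(1 - v) *\<^sub>R (c - a) + v *\<^sub>R (c - b) = 0" unfolding v(1) by (simp add: algebra_simps)
        finally show ?thesis by simp
      qed
      moreover have "(1 - v) * X + v * Y > 0"
      proof (cases "v = 1")
        case False
        then have "(1 - v) * X > 0" using v(3) \<open>X > 0\<close> by simp
        moreover have "v * Y \<ge> 0" using v(2) \<open>Y > 0\<close> by simp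
        ultimately show ?thesis by linarith
      qed (use \<open>Y > 0\<close> in simp)
      ultimately show False by simp
    qed
    then have "s *\<^sub>R a + t *\<^sub>R b \<in> U" using 1 by (metis (no_types, lifting) in_segment(1) add.commute diff_add_cancel le_add_same_cancel1 subsetD add_diff_cancel_right')
    then show ?case using bD unfolding U_def by force
  qed
qed

text \<open>With \<open>K\<close> a primitive of \<open>k\<close>, the composition of \<open>f\<close> with the inverse of \<open>K\<close> has derivative of
  positive real part on the convex domain \<open>K ` \<DD>\<close>, whereas \<open>u * k u\<close> is an outer normal at \<open>K u\<close>.\<close>
lemma close_to_convex_ray:
  assumes k: "k holomorphic_on \<DD>" "\<And>z. z \<in> \<DD> \<Longrightarrow> k z \<noteq> 0"
    and st: "\<And>z. z \<in> \<DD> \<Longrightarrow> Re (1 + z * deriv k z / k z) > 0"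
    and f: "f holomorphic_on \<DD>" "\<And>z. z \<in> \<DD> \<Longrightarrow> Re (deriv f z / k z) > 0"
    and u: "u \<in> \<DD>" and z: "norm z \<le> norm u" "z \<noteq> u" and t: "t \<ge> 0"
  shows "f z \<noteq> f u + of_real t * (u * k u)"
proof
  assume eq: "f z = f u + of_real t * (u * k u)"
  obtain K where K: "\<And>z. z \<in> \<DD> \<Longrightarrow> (K has_field_derivative k z) (at z)"
    using holomorphic_convex_primitive'[OF convex_ball open_ball k(1)] by (metis at_within_open open_ball)
  have holK: "K holomorphic_on \<DD>" by (rule holomorphic_onI) (use K field_differentiable_at_within field_differentiable_def in blast)
  have cv: "inj_on K \<DD>" "convex (K ` \<DD>)"
    using convex_function_convex_image[of k K] k st K by auto
  obtain g where g: "g holomorphic_on K ` \<DD>" "\<And>z. z \<in> \<DD> \<Longrightarrow> deriv K z * deriv g (K z) = 1" "\<And>z. z \<in> \<DD> \<Longrightarrow> g (K z) = z"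
    using holomorphic_has_inverse[OF holK open_ball cv(1)] by metis
  have oK: "open (K ` \<DD>)" by (rule open_mapping_thm3[OF holK open_ball cv(1)])
  have zD: "z \<in> \<DD>" and u0: "u \<noteq> 0" using z u by auto
  define a b d where "a = K u" "b = K z" "d = b - a"
  have d0: "d \<noteq> 0" using inj_onD[OF cv(1) _ zD u] z by (auto simp: a_b_d_def)
  \<comment> \<open>Dividing by \<open>d\<close> makes the derivative along the segment from
    \<open>K u\<close> to \<open>K z\<close> equal to \<open>Re (deriv f x / k x)\<close>, where
    \<open>K x\<close> is the current point.\<close>
  define G where "G = (\<lambda>s::real. Re (f (g (a + of_real s * d)) / d))"
  have seg: "a + of_real s * d \<in> K ` \<DD>" if "0 \<le> s" "s \<le> 1" for s
  proof -
    have "a + of_real s * d = (1 - s) *\<^sub>R a + s *\<^sub>R b" by (simp add: a_b_d_def scaleR_conv_of_real algebra_simps)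
    also have "\<dots> \<in> K ` \<DD>" using convexD[OF cv(2), of a b "1 - s" s] u zD that by (simp add: a_b_d_def)
    finally show ?thesis .
  qed
  have G': "\<exists>y. DERIV G s :> y \<and> y > 0" if "0 \<le> s" "s \<le> 1" for s
  proof -
    obtain x where x: "x \<in> \<DD>" "a + of_real s * d = K x" using seg \<open>0 \<le> s\<close> \<open>s \<le> 1\<close> by blast
    have "deriv K x = k x" using K[OF x(1)] DERIV_imp_deriv by blast
    then have g': "deriv g (K x) = 1 / k x" using g(2)[OF x(1)] k(2)[OF x(1)] by (simp add: field_simps)
    have "(g has_field_derivative 1 / k x) (at (a + of_real s * d))"
      using holomorphic_derivI[OF g(1) oK, of "K x"] x g' by simp
    moreover have "(f has_field_derivative deriv f x) (at (g (a + of_real s * d)))"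
      using holomorphic_derivI[OF f(1) open_ball x(1)] x g(3) by simp
    ultimately have "((\<lambda>s. f (g (a + s * d)) / d) has_field_derivative deriv f x * (1 / k x * d) / d) (at (of_real s))"
      by (intro DERIV_cdivide DERIV_chain2[of f] DERIV_chain2[of g]) (auto intro!: derivative_eq_intros)
    then have "((\<lambda>s. f (g (a + of_real s * d)) / d) has_vector_derivative deriv f x / k x) (at s)"
      using has_vector_derivative_real_field[of "\<lambda>s. f (g (a + s * d)) / d"] d0 by simp
    from has_field_derivative_Re[OF this] show ?thesis
      using f(2)[OF x(1)] unfolding G_def by blast
  qed
  have "G 0 < G 1" by (rule DERIV_pos_imp_increasing) (use G' in auto)
  moreover have "a + of_real 1 * d = K z" by (simp add: a_b_d_def)
  ultimately have "Re ((f z - f u) / d) > 0" using g(3) zD u by (simp add: G_def a_b_d_def diff_divide_distrib)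
  then have "Re (of_real t * (u * k u / d)) > 0" using eq by simp
  then have "t * Re (u * k u / d) > 0" by (simp only: Re_complex_of_real times_complex.sel Im_complex_of_real)
  then have p: "Re (u * k u / d) > 0" using t by (simp add: zero_less_mult_iff)
  \<comment> \<open>The quotient here is \<open>- inverse (u * k u / d)\<close>, and inversion
    preserves the sign of the real part; this contradicts \<open>p\<close>.\<close>
  have "Re ((K u - K z) / (u * k u)) > 0" by (rule convex_support) (use k st K u u0 z in auto)
  then have "Re (- inverse (u * k u / d)) > 0" by (simp add: a_b_d_def minus_divide_left)
  then have "Re (inverse (u * k u / d)) < 0" by simp
  moreover have "Re (inverse x) \<ge> 0" if "Re x > 0" for x :: complex
    using that by (simp add: complex_inverse)
  ultimately show False using p by fastforce
qed

section \<open>Jack's lemma and the first exit point\<close>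

text \<open>After rescaling, the Schwarz lemma bounds \<open>F x\<close> by \<open>norm x\<close>
  with equality at the boundary point 1. Comparing first-order terms along every direction into the
  disc shows that the derivative at 1 is real and at least 1.\<close>

lemma jack_at_boundary_point:
  assumes v: "v holomorphic_on ball 0 (norm z)" "v 0 = 0"
      "\<And>x. norm x < norm z \<Longrightarrow> norm (v x) < norm (v z)"
    and d: "(v has_field_derivative d) (at z)" and z: "z \<noteq> 0"
  obtains m :: real where "m \<ge> 1" "z * d = of_real m * v z"
proof -
  have vz: "v z \<noteq> 0" using v(3)[of 0] z by auto
  define F a where "F = (\<lambda>x. v (z * x) / v z)" and "a = z * d / v z"
  have "F holomorphic_on \<DD>"
    unfolding F_def
    by (intro holomorphic_intros holomorphic_on_compose_gen[OF _ v(1), unfolded o_def])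
      (use z vz in \<open>auto simp: norm_mult\<close>)
  moreover have "norm (F x) < 1" if "norm x < 1" for x
    using v(3)[of "z * x"] that z vz by (simp add: F_def norm_divide norm_mult)
  ultimately have Sch: "norm (F x) \<le> norm x" if "norm x < 1" for x
    using Schwarz_Lemma(1)[of F x] that v(2) by (simp add: F_def)
  have F': "(F has_field_derivative a) (at 1)"
  proof -
    have "((\<lambda>x. z * x) has_field_derivative z) (at 1)" by (auto intro!: derivative_eq_intros)
    then have "((\<lambda>x. v (z * x)) has_field_derivative d * z) (at 1)"
      using DERIV_chain2[of v d "\<lambda>x. z * x" 1] d by simp
    from DERIV_cdivide[OF this, of "v z"] show ?thesis by (simp add: F_def a_def mult.commute)
  qed
  \<comment> \<open>Letting \<open>u\<close> range over the right half-plane forces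
    \<open>a - 1\<close> to be real and nonnegative.\<close>
  have key: "Re ((a - 1) * u) \<ge> 0" if u: "Re u > 0" for u
  proof (rule ccontr)
    assume neg: "\<not> ?thesis"
    have un: "u \<noteq> 0" using u by auto
    \<comment> \<open>The subtracted polynomial is \<open>(1 + norm (1 - t * u)^2) / 2\<close>. So
      \<open>\<psi>\<close> vanishes at 0 with derivative \<open>- Re ((a - 1) * u)\<close>, and is
      at most 0 as long as \<open>1 - t * u\<close> stays in the disc.\<close>
    define \<psi> where "\<psi> = (\<lambda>t::real. Re (F (1 - of_real t * u)) - (1 - t * Re u + t ^ 2 * (norm u)\<^sup>2 / 2))"
    have "((\<lambda>t::real. 1 - of_real t * u) has_vector_derivative - u) (at 0)"
      by (auto intro!: derivative_eq_intros)
    from field_vector_diff_chain_at[OF this, of F a] F'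
    have "((\<lambda>t. F (1 - of_real t * u)) has_vector_derivative - u * a) (at 0)"
      by (simp add: o_def)
    from has_field_derivative_Re[OF this]
    have "((\<lambda>t. Re (F (1 - of_real t * u))) has_real_derivative Re (- u * a)) (at 0)" .
    moreover have "((\<lambda>t. 1 - t * Re u + t ^ 2 * (norm u)\<^sup>2 / 2) has_real_derivative - Re u) (at 0)"
      by (auto intro!: derivative_eq_intros)
    ultimately have "(\<psi> has_real_derivative Re (- u * a) - (- Re u)) (at 0)"
      unfolding \<psi>_def by (rule DERIV_diff)
    moreover have "Re (- u * a) - (- Re u) > 0" using neg by (simp add: algebra_simps)
    ultimately obtain e where e: "e > 0" "\<And>h. h > 0 \<Longrightarrow> h < e \<Longrightarrow> \<psi> 0 < \<psi> h"
      using DERIV_pos_inc_right by fastforce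
    \<comment> \<open>The second bound keeps \<open>1 - h * u\<close> inside the unit disc.\<close>
    define h where "h = min (e / 2) (Re u / (norm u)\<^sup>2)"
    have h: "h > 0" "h < e" using e u un by (auto simp: h_def)
    have sq: "(norm (1 - of_real h * u))\<^sup>2 = 1 - 2 * h * Re u + h\<^sup>2 * (norm u)\<^sup>2"
      unfolding cmod_power2 by (simp add: power2_eq_square algebra_simps)
    have "h * (norm u)\<^sup>2 \<le> Re u / (norm u)\<^sup>2 * (norm u)\<^sup>2"
      by (intro mult_right_mono) (auto simp: h_def)
    then have "h * (norm u)\<^sup>2 \<le> Re u" using un by simp
    then have "h * (h * (norm u)\<^sup>2) \<le> h * Re u" using h by simp
    moreover have "h * Re u > 0" using h u by simp
    ultimately have "h\<^sup>2 * (norm u)\<^sup>2 < 2 * h * Re u" by (simp add: power2_eq_square)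
    then have "(norm (1 - of_real h * u))\<^sup>2 < 1\<^sup>2" using sq by simp
    then have n1: "norm (1 - of_real h * u) < 1" using power2_less_imp_less by fastforce
    \<comment> \<open>AM-GM replaces the norm by a quadratic polynomial in \<open>h\<close>.\<close>
    have "Re (F (1 - of_real h * u)) \<le> norm (1 - of_real h * u)"
      using Sch[OF n1] complex_Re_le_cmod order_trans by blast
    also have "\<dots> \<le> (1 + (norm (1 - of_real h * u))\<^sup>2) / 2"
      using sum_squares_bound[of 1 "norm (1 - of_real h * u)"] by simp
    finally have "\<psi> h \<le> 0" unfolding \<psi>_def sq by (simp add: field_simps)
    moreover have "\<psi> 0 = 0" using vz by (simp add: \<psi>_def F_def)
    ultimately show False using e(2)[OF h] by simp
  qed
  have "Im a = 0"
  proof (rule ccontr)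
    assume "Im a \<noteq> 0"
    \<comment> \<open>For this \<open>u\<close> the real part of \<open>(a - 1) * u\<close> is
      exactly -1.\<close>
    then show False using key[of "Complex 1 (Re a / Im a)"] by simp
  qed
  moreover have "Re a \<ge> 1" using key[of 1] by simp
  moreover have "z * d = a * v z" using vz by (simp add: a_def)
  ultimately show thesis using that[of "Re a"] by (simp add: complex_eq_iff)
qed

text \<open>Subordination to a univalent \<open>q\<close> with the same value at 0 amounts to
  inclusion of images, so its failure gives a point where \<open>p\<close> leaves the image of
  \<open>q\<close>. The lift \<open>v\<close> of \<open>p\<close> through \<open>q\<close> attains
  its largest modulus over the disc up to the exit point at that point, and Jack's lemma applies to
  it.\<close>

lemma first_exit:
  fixes p q :: "complex \<Rightarrow> complex"
  assumes p: "p holomorphic_on \<DD>" and q: "univalent q" and pq: "p 0 = q 0" and n: "\<not> p \<prec> q"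
  obtains z u v and m :: real
  where "u \<in> \<DD>" "norm z < norm u" "m \<ge> 1" "z * deriv p z = of_real m * (u * deriv q u)"
    "continuous_on (insert z (ball 0 (norm z))) v" "v ` insert z (ball 0 (norm z)) \<subseteq> \<DD>" "v 0 = 0" "v z = u"
    "\<And>x. x \<in> insert z (ball 0 (norm z)) \<Longrightarrow> p x = q (v x)" "z \<noteq> 0"
proof -
  have qh: "q holomorphic_on \<DD>" and qi: "inj_on q \<DD>" using q by (auto simp: univalent_def)
  obtain g where g: "g holomorphic_on q ` \<DD>" "\<And>z. z \<in> \<DD> \<Longrightarrow> deriv q z * deriv g (q z) = 1"
      "\<And>z. z \<in> \<DD> \<Longrightarrow> g (q z) = z"
    using holomorphic_has_inverse[OF qh open_ball qi] by metis
  have oq: "open (q ` \<DD>)" by (rule open_mapping_thm3[OF qh open_ball qi])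
  have "\<not> p ` \<DD> \<subseteq> q ` \<DD>"
  proof
    assume sub: "p ` \<DD> \<subseteq> q ` \<DD>"
    have "(g \<circ> p) holomorphic_on \<DD>" by (rule holomorphic_on_compose_gen[OF p g(1) sub])
    moreover have "g (p z) \<in> \<DD> \<and> p z = q (g (p z))" if "z \<in> \<DD>" for z
    proof -
      obtain x where "x \<in> \<DD>" "p z = q x" using sub \<open>z \<in> \<DD>\<close> by blast
      then show ?thesis using g(3)[of x] by simp
    qed
    moreover have "g (p 0) = 0" using g(3)[of 0] pq by simp
    ultimately have "p \<prec> q" unfolding subordinate_def using p qh
      by (intro conjI exI[of _ "g \<circ> p"]) auto
    then show False using n by simp
  qed
  then obtain z1 where z1: "z1 \<in> \<DD>" "p z1 \<notin> q ` \<DD>" by blast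
  \<comment> \<open>Taking \<open>\<rho>\<close> above \<open>norm z1\<close> is what yields
    \<open>norm z < norm u\<close>, since \<open>norm u = \<rho>\<close> and
    \<open>norm z \<le> norm z1\<close>.\<close>
  obtain \<rho> where \<rho>: "norm z1 < \<rho>" "\<rho> < 1" using z1 dense[of "norm z1" 1] by auto
  have \<rho>D: "cball 0 \<rho> \<subseteq> \<DD>" using \<rho> by auto
  have z1D: "cball 0 (norm z1) \<subseteq> \<DD>" using z1 by auto
  define W where "W = q ` ball 0 \<rho>"
  have WD: "W \<subseteq> q ` \<DD>" unfolding W_def using \<rho>D ball_subset_cball by blast
  have oW: "open W" unfolding W_def
    by (rule open_mapping_thm3)
      (use holomorphic_on_subset[OF qh] inj_on_subset[OF qi] order_trans[OF ball_subset_cball \<rho>D] in auto)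
  have pc: "continuous_on \<DD> p" by (rule holomorphic_on_imp_continuous_on[OF p])
  \<comment> \<open>The points where \<open>p\<close> is outside \<open>W\<close>; one of least
    modulus is the first exit.\<close>
  define B where "B = cball 0 (norm z1) \<inter> p -` (- W)"
  have "closed B" unfolding B_def
    by (intro continuous_closed_preimage[OF continuous_on_subset[OF pc z1D]] closed_cball closed_Compl oW)
  moreover have "bounded B" by (rule bounded_subset[of "cball 0 (norm z1)"]) (auto simp: B_def)
  ultimately have "compact B" by (simp add: compact_eq_bounded_closed)
  moreover have "z1 \<in> B" using z1 WD by (auto simp: B_def)
  ultimately obtain z where z: "z \<in> B" "\<And>x. x \<in> B \<Longrightarrow> norm z \<le> norm x"
    using continuous_attains_inf[of B norm] by (auto intro: continuous_on_norm_id)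
  have zb: "norm z \<le> norm z1" "p z \<notin> W" using z(1) by (auto simp: B_def)
  have zD: "z \<in> \<DD>" using zb z1 by simp
  have inW: "p x \<in> W" if "norm x < norm z" for x
    using z(2)[of x] that zb by (force simp: B_def)
  have \<rho>0: "\<rho> > 0" using \<rho> norm_ge_zero[of z1] by linarith
  have z0: "z \<noteq> 0" using zb \<rho>0 pq by (auto simp: W_def)
  have "compact (q ` cball 0 \<rho>)"
    by (intro compact_continuous_image holomorphic_on_imp_continuous_on holomorphic_on_subset[OF qh] \<rho>D compact_cball)
  then have clW: "closure W \<subseteq> q ` cball 0 \<rho>"
    by (intro closure_minimal compact_imp_closed) (auto simp: W_def)
  have cb: "closure (ball (0::complex) (norm z)) = cball 0 (norm z)" using z0 by (intro closure_ball) simp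
  have "p ` closure (ball 0 (norm z)) \<subseteq> closure (p ` ball 0 (norm z))"
    by (rule image_closure_subset[OF continuous_on_subset[OF pc]]) (use zD cb closure_subset[of "p ` ball 0 (norm z)"] in auto)
  also have "\<dots> \<subseteq> closure W" by (rule closure_mono) (use inW in auto)
  finally have "p ` closure (ball 0 (norm z)) \<subseteq> q ` cball 0 \<rho>" using clW by (rule order_trans)
  moreover have "z \<in> closure (ball 0 (norm z))" unfolding cb by simp
  ultimately have "p z \<in> q ` cball 0 \<rho>" by blast
  then obtain u where u: "norm u \<le> \<rho>" "p z = q u" by auto
  have u\<rho>: "norm u = \<rho>" using u zb by (force simp: W_def)
  have uD: "u \<in> \<DD>" using u\<rho> \<rho> by simp
  define V where "V = \<DD> \<inter> p -` (q ` \<DD>)"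
  have VD: "V \<subseteq> \<DD>" by (auto simp: V_def)
  define v where "v = g \<circ> p"
  have pv: "v x \<in> \<DD> \<and> p x = q (v x)" if "x \<in> V" for x
    using that g(3) by (auto simp: V_def v_def)
  have vh: "v holomorphic_on V" unfolding v_def
    by (rule holomorphic_on_compose_gen[OF holomorphic_on_subset[OF p VD] g(1)]) (auto simp: V_def)
  have zV: "z \<in> V" using zD u uD by (auto simp: V_def)
  have bV: "ball 0 (norm z) \<subseteq> V" using inW WD zD by (force simp: V_def)
  have v0: "v 0 = 0" using g(3)[of 0] pq by (simp add: v_def)
  have vz: "v z = u" using g(3)[OF uD] u(2) by (simp add: v_def)
  have vlt: "norm (v x) < norm (v z)" if x: "norm x < norm z" for x
  proof -
    obtain y where "norm y < \<rho>" "p x = q y" using inW[OF x] by (auto simp: W_def)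
    then show ?thesis using g(3)[of y] \<rho> vz u\<rho> by (simp add: v_def)
  qed
  have pd: "(p has_field_derivative deriv p z) (at z)" by (rule holomorphic_derivI[OF p open_ball zD])
  have gd: "(g has_field_derivative deriv g (q u)) (at (p z))"
    using holomorphic_derivI[OF g(1) oq, of "q u"] uD u(2) by simp
  have vd: "(v has_field_derivative deriv g (q u) * deriv p z) (at z)"
    unfolding v_def by (rule DERIV_chain[OF gd pd])
  obtain m where m: "m \<ge> 1" "z * (deriv g (q u) * deriv p z) = of_real m * v z"
    using jack_at_boundary_point[OF holomorphic_on_subset[OF vh bV] v0 vlt vd z0] by blast
  have "z * deriv p z = z * (deriv g (q u) * deriv p z) * deriv q u"
    using g(2)[OF uD] by (simp add: algebra_simps)
  also have "\<dots> = of_real m * (u * deriv q u)" using m(2) vz by simp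
  finally have e: "z * deriv p z = of_real m * (u * deriv q u)" .
  have ins: "insert z (ball 0 (norm z)) \<subseteq> V" using zV bV by simp
  show thesis
    by (rule that[OF uD _ m(1) e _ _ v0 vz _ z0])
      (use u\<rho> \<rho> zb ins pv holomorphic_on_imp_continuous_on[OF holomorphic_on_subset[OF vh ins]] in auto)
qed

section \<open>Principal powers on the disc\<close>

text \<open>The image of a principal power with exponent \<open>\<mu> < 1\<close> stays in the sector of arguments at most
  \<open>\<mu> * pi\<close>; by the open mapping theorem a nonconstant one cannot touch the edge of that sector, nor 0.\<close>
lemma powr_holomorphic_imp_Ln:
  assumes \<mu>: "0 < \<mu>" "\<mu> < (1::real)"
    and h: "(\<lambda>z. F z powr of_real \<mu>) holomorphic_on \<DD>" and F: "F holomorphic_on \<DD>"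
  shows "(\<forall>z\<in>\<DD>. F z = 0) \<or> ((\<forall>z\<in>\<DD>. F z \<noteq> 0) \<and> (\<lambda>z. Ln (F z)) holomorphic_on \<DD>)"
proof -
  define g where "g = (\<lambda>z. F z powr of_real \<mu>)"
  have gh: "g holomorphic_on \<DD>" using h by (simp add: g_def)
  \<comment> \<open>An exponent below 1 keeps \<open>\<mu> * Ln (F z)\<close> in the principal
    strip.\<close>
  have Ln_g: "Ln (g z) = of_real \<mu> * Ln (F z)" if "F z \<noteq> 0" for z
  proof -
    have I: "- pi < Im (Ln (F z))" "Im (Ln (F z)) \<le> pi" using that mpi_less_Im_Ln Im_Ln_le_pi by auto
    have "\<mu> * Im (Ln (F z)) \<le> \<mu> * pi" using I \<mu> by simp
    moreover have "\<mu> * (- pi) < \<mu> * Im (Ln (F z))" using I \<mu> by (intro mult_strict_left_mono) auto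
    moreover have "\<mu> * pi < pi" using \<mu> by simp
    ultimately have "- pi < \<mu> * Im (Ln (F z))" "\<mu> * Im (Ln (F z)) \<le> pi" by linarith+
    then show ?thesis using that by (simp add: g_def powr_def)
  qed
  have g0: "g z = 0 \<longleftrightarrow> F z = 0" for z by (simp add: g_def powr_def)
  show ?thesis
  proof (cases "g constant_on \<DD>")
    case True
    then obtain c where c: "\<And>z. z \<in> \<DD> \<Longrightarrow> g z = c" by (auto simp: constant_on_def)
    show ?thesis
    proof (cases "c = 0")
      case True
      then show ?thesis using c g0 by auto
    next
      case False
      then have nz: "F z \<noteq> 0" if "z \<in> \<DD>" for z using c[OF that] g0[of z] by auto
      have "Ln (F z) = Ln c / of_real \<mu>" if "z \<in> \<DD>" for z
        using Ln_g[OF nz[OF that]] c[OF that] \<mu> by (simp add: field_simps)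
      then have "(\<lambda>z. Ln (F z)) holomorphic_on \<DD> \<longleftrightarrow> (\<lambda>_. Ln c / of_real \<mu>) holomorphic_on \<DD>"
        by (intro holomorphic_cong) auto
      then show ?thesis using nz by simp
    qed
  next
    case False
    have op: "open (g ` \<DD>)"
      by (rule open_mapping_thm[OF gh open_ball _ open_ball order_refl False]) simp
    have "F z \<notin> \<real>\<^sub>\<le>\<^sub>0" if z: "z \<in> \<DD>" for z
    proof
      assume "F z \<in> \<real>\<^sub>\<le>\<^sub>0"
      have le: "Im (Ln y) \<le> \<mu> * pi" if "y \<in> g ` \<DD>" "y \<noteq> 0" for y
      proof -
        obtain x where x: "y = g x" using \<open>y \<in> g ` \<DD>\<close> by blast
        then have "F x \<noteq> 0" using that(2) g0 by simp
        then show ?thesis using Ln_g[of x] Im_Ln_le_pi[of "F x"] \<mu> x by simp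
      qed
      obtain e where e: "e > 0" "ball (g z) e \<subseteq> g ` \<DD>"
        using op z by (meson imageI openE)
      show False
      proof (cases "F z = 0")
        case True
        \<comment> \<open>Near 0 the open image would contain negative reals, whose argument
          \<open>pi\<close> exceeds \<open>\<mu> * pi\<close>.\<close>
        define y where "y = complex_of_real (- (e / 2))"
        have "y \<in> ball (g z) e" using True g0[of z] e(1) by (simp add: y_def)
        moreover have y0: "y \<noteq> 0" using e(1) by (simp add: y_def)
        ultimately have "Im (Ln y) \<le> \<mu> * pi" using e(2) by (intro le) auto
        moreover have "Im (Ln y) = pi"
          using Im_Ln_eq_pi[OF y0] e(1) by (simp add: y_def)
        ultimately show False using \<mu> by simp
      next
        case nz: False
        then have ImF: "Im (Ln (F z)) = pi" using \<open>F z \<in> \<real>\<^sub>\<le>\<^sub>0\<close>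
          by (metis Im_Ln_eq_pi complex_eq_iff complex_nonpos_Reals_iff order_le_less zero_complex.sel)
        \<comment> \<open>Here \<open>g z\<close> has argument exactly \<open>\<mu> * pi\<close>, so
          a slight counterclockwise rotation leaves the sector but stays in the open image. Angles
          below \<open>(1 - \<mu>) * pi\<close> keep the argument principal.\<close>
        have "((\<lambda>t::real. g z * exp (\<i> * of_real t)) \<longlongrightarrow> g z * exp (\<i> * of_real 0)) (at_right 0)"
          by (intro tendsto_intros)
        then have "\<forall>\<^sub>F t in at_right 0. g z * exp (\<i> * of_real t) \<in> ball (g z) e"
          by (rule topological_tendstoD) (use e in auto)
        moreover have "\<forall>\<^sub>F t in at_right 0. t \<in> {0<..<(1 - \<mu>) * pi}"
          using \<mu> by (intro eventually_at_right_real) simp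
        ultimately have "\<forall>\<^sub>F t in at_right (0::real). False"
        proof eventually_elim
          case (elim t)
          define s where "s = of_real \<mu> * Ln (F z) + \<i> * of_real t"
          have gs: "g z * exp (\<i> * of_real t) = exp s"
            using nz by (simp add: s_def g_def powr_def exp_add)
          have Ims: "Im s = \<mu> * pi + t" using ImF by (simp add: s_def)
          have "\<mu> * pi > 0" using \<mu> by simp
          then have "Ln (exp s) = s"
            using elim(2) Ims by (intro Ln_exp) (auto simp: algebra_simps intro: less_trans[of _ 0])
          moreover have "Im (Ln (exp s)) \<le> \<mu> * pi" using le[of "exp s"] e(2) elim(1) gs by auto
          ultimately show ?case using Ims elim(2) by simp
        qed
        then show False by simp
      qed
    qed
    then have "(\<lambda>z. Ln (F z)) holomorphic_on \<DD>" by (intro holomorphic_on_Ln' F) auto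
    moreover have "F z \<noteq> 0" if "z \<in> \<DD>" for z using \<open>\<And>z. z \<in> \<DD> \<Longrightarrow> F z \<notin> \<real>\<^sub>\<le>\<^sub>0\<close>[OF that] by auto
    ultimately show ?thesis by blast
  qed
qed

lemma class_RD:
  assumes "p \<in> class_R \<alpha> \<beta> \<gamma> \<delta> \<mu>"
  shows "p holomorphic_on \<DD>" "p 0 = 1" "\<And>z. z \<in> \<DD> \<Longrightarrow> p z \<noteq> 0" "\<And>z. z \<in> \<DD> \<Longrightarrow> \<beta> * p z + \<gamma> \<noteq> 0"
    "(\<lambda>z. p z powr of_real \<alpha>) holomorphic_on \<DD>"
    "(\<lambda>z. (p z + \<delta> + z * deriv p z / (\<beta> * p z + \<gamma>)) powr of_real \<mu>) holomorphic_on \<DD>"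
    "disc_log p holomorphic_on \<DD>" "disc_log p 0 = 0" "\<And>z. z \<in> \<DD> \<Longrightarrow> exp (disc_log p z) = p z"
  using assms disc_log[of p] by (auto simp: class_R_def)

lemma S_fun_eq:
  assumes p: "p \<in> class_R \<alpha> \<beta> \<gamma> \<delta> \<mu>" and z: "z \<in> \<DD>"
  shows "S_fun \<alpha> \<beta> \<gamma> \<delta> \<mu> p z =
    disc_power p (of_real (\<alpha> / \<mu>)) z * (p z + \<delta> + z * deriv p z / (\<beta> * p z + \<gamma>))"
proof -
  have "disc_power p (of_real (\<alpha> / \<mu> + 1)) z = disc_power p (of_real (\<alpha> / \<mu>)) z * p z"
    using class_RD(9)[OF p z] by (simp add: disc_power_def exp_add distrib_right)
  then show ?thesis unfolding S_fun_def by (simp add: algebra_simps)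
qed

text \<open>The case \<open>1 + \<delta> = 0\<close> is degenerate: for \<open>\<mu> < 1\<close> the base of the second power then vanishes at 0
  and hence, its principal power being analytic, identically.\<close>
lemma S_fun_factor:
  assumes p: "p \<in> class_R \<alpha> \<beta> \<gamma> \<delta> \<mu>" and q: "q \<in> class_R \<alpha> \<beta> \<gamma> \<delta> \<mu>" and \<mu>: "0 < \<mu>" "\<mu> \<le> 1"
    and w: "w holomorphic_on \<DD>" "w ` \<DD> \<subseteq> \<DD>" "w 0 = 0"
    and P: "\<And>z. z \<in> \<DD> \<Longrightarrow> P_fun \<alpha> \<beta> \<gamma> \<delta> \<mu> p z = P_fun \<alpha> \<beta> \<gamma> \<delta> \<mu> q (w z)"
    and z: "z \<in> \<DD>"
  shows "S_fun \<alpha> \<beta> \<gamma> \<delta> \<mu> p z = S_fun \<alpha> \<beta> \<gamma> \<delta> \<mu> q (w z)"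
proof -
  define F where "F = (\<lambda>(p::complex \<Rightarrow> complex) z. p z + \<delta> + z * deriv p z / (\<beta> * p z + \<gamma>))"
  have wD: "w x \<in> \<DD>" if "x \<in> \<DD>" for x using w(2) that by blast
  have pow: "r x powr of_real \<alpha> = exp (of_real \<alpha> * disc_log r x)"
    if "r \<in> class_R \<alpha> \<beta> \<gamma> \<delta> \<mu>" "x \<in> \<DD>" for r x
    using disc_power_eq_powr[of r "of_real \<alpha>" x] class_RD[OF that(1)] that(2) by (simp add: disc_power_def)
  have Pr: "P_fun \<alpha> \<beta> \<gamma> \<delta> \<mu> r x = exp (of_real \<alpha> * disc_log r x) * F r x powr of_real \<mu>"
    if "r \<in> class_R \<alpha> \<beta> \<gamma> \<delta> \<mu>" "x \<in> \<DD>" for r x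
    unfolding P_fun_def F_def pow[OF that] ..
  have Sr: "S_fun \<alpha> \<beta> \<gamma> \<delta> \<mu> r x = exp (of_real (\<alpha> / \<mu>) * disc_log r x) * F r x"
    if "r \<in> class_R \<alpha> \<beta> \<gamma> \<delta> \<mu>" "x \<in> \<DD>" for r x
    unfolding S_fun_eq[OF that] F_def disc_power_def ..
  show ?thesis
  proof (cases "\<mu> = 1")
    case True
    then show ?thesis
      using P[OF z] Pr[OF p z] Pr[OF q wD[OF z]] Sr[OF p z] Sr[OF q wD[OF z]] by simp
  next
    case False
    then have \<mu>1: "\<mu> < 1" using \<mu> by simp
    have F0: "F r 0 = 1 + \<delta>" if "r \<in> class_R \<alpha> \<beta> \<gamma> \<delta> \<mu>" for r
      using class_RD(2)[OF that] by (simp add: F_def)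
    have alt: "(\<forall>z\<in>\<DD>. F r z = 0) \<or> ((\<forall>z\<in>\<DD>. F r z \<noteq> 0) \<and> (\<lambda>z. Ln (F r z)) holomorphic_on \<DD>)"
      if "r \<in> class_R \<alpha> \<beta> \<gamma> \<delta> \<mu>" for r
    proof (rule powr_holomorphic_imp_Ln[OF \<mu>(1) \<mu>1])
      show "(\<lambda>z. F r z powr of_real \<mu>) holomorphic_on \<DD>"
        unfolding F_def by (rule class_RD(6)[OF that])
      show "F r holomorphic_on \<DD>"
        unfolding F_def using class_RD(1,4)[OF that] by (intro holomorphic_intros) auto
    qed
    show ?thesis
    proof (cases "1 + \<delta> = 0")
      case True
      then have "F r x = 0" if "r \<in> class_R \<alpha> \<beta> \<gamma> \<delta> \<mu>" "x \<in> \<DD>" for r x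
        using alt[OF that(1)] F0[OF that(1)] that(2) by fastforce
      then show ?thesis using Sr[OF p z] Sr[OF q wD[OF z]] p q z wD[OF z] by simp
    next
      case False
      then have nz: "F r x \<noteq> 0" and Ln: "(\<lambda>z. Ln (F r z)) holomorphic_on \<DD>"
        if "r \<in> class_R \<alpha> \<beta> \<gamma> \<delta> \<mu>" "x \<in> \<DD>" for r x
        using alt[OF that(1)] F0[OF that(1)] that(2) by fastforce+
      \<comment> \<open>\<open>M r\<close> is an analytic logarithm of \<open>P_fun\<close> of
        \<open>r\<close>, and \<open>M r / \<mu>\<close> is one of \<open>S_fun\<close>. Both
        \<open>M p\<close> and the composition of \<open>M q\<close> with \<open>w\<close> start at
        \<open>\<mu> * Ln (1 + \<delta>)\<close>, so equality of the \<open>P_fun\<close> values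
        lifts to the logarithms and passes to \<open>S_fun\<close>.\<close>
      define M where "M = (\<lambda>r z. of_real \<alpha> * disc_log r z + of_real \<mu> * Ln (F r z))"
      have M: "M r holomorphic_on \<DD>" if "r \<in> class_R \<alpha> \<beta> \<gamma> \<delta> \<mu>" for r
        unfolding M_def
        by (intro holomorphic_on_add holomorphic_on_mult holomorphic_on_const class_RD(7)[OF that] Ln[OF that, of 0]) simp
      have PM: "P_fun \<alpha> \<beta> \<gamma> \<delta> \<mu> r x = exp (M r x)" if "r \<in> class_R \<alpha> \<beta> \<gamma> \<delta> \<mu>" "x \<in> \<DD>" for r x
        using Pr[OF that] nz[OF that] by (simp add: M_def powr_def exp_add)
      have SM: "S_fun \<alpha> \<beta> \<gamma> \<delta> \<mu> r x = exp (M r x / of_real \<mu>)"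
        if "r \<in> class_R \<alpha> \<beta> \<gamma> \<delta> \<mu>" "x \<in> \<DD>" for r x
      proof -
        have "M r x / of_real \<mu> = of_real (\<alpha> / \<mu>) * disc_log r x + Ln (F r x)"
          using \<mu> by (simp add: M_def field_simps)
        then show ?thesis using Sr[OF that] nz[OF that] by (simp add: exp_add)
      qed
      have "M p z = M q (w z)"
      proof (rule exp_eq_on_connected[where S = \<DD> and a = 0 and f = "M p" and g = "\<lambda>z. M q (w z)"])
        show "continuous_on \<DD> (M p)" using M[OF p] by (rule holomorphic_on_imp_continuous_on)
        show "continuous_on \<DD> (\<lambda>z. M q (w z))"
          using holomorphic_on_compose_gen[OF w(1) M[OF q] w(2)]
          by (simp add: o_def holomorphic_on_imp_continuous_on)
        show "exp (M p x) = exp (M q (w x))" if "x \<in> \<DD>" for x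
          using P[OF that] PM[OF p that] PM[OF q wD[OF that]] by simp
        show "M p 0 = M q (w 0)"
          using class_RD(8)[OF p] class_RD(8)[OF q] F0[OF p] F0[OF q] w(3) by (simp add: M_def)
      qed (use z in auto)
      then show ?thesis using SM[OF p z] SM[OF q wD[OF z]] by simp
    qed
  qed
qed

section \<open>The chain G + s z k\<close>

text \<open>In the notation of Miller and Mocanu these are \<open>\<theta>(q)\<close> and \<open>q' \<phi>(q)\<close> for
  \<open>\<theta>(w) = w\<^sup>a\<^sup>+\<^sup>1 + \<delta> w\<^sup>a\<close> and \<open>\<phi>(w) = w\<^sup>a / (\<beta> w + \<gamma>)\<close>, with the analytic branches of the powers of \<open>q\<close>.\<close>
definition theta_part :: "real \<Rightarrow> complex \<Rightarrow> (complex \<Rightarrow> complex) \<Rightarrow> complex \<Rightarrow> complex"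
  where "theta_part a \<delta> q z = disc_power q (of_real (a + 1)) z + \<delta> * disc_power q (of_real a) z"

definition phi_part :: "real \<Rightarrow> complex \<Rightarrow> complex \<Rightarrow> (complex \<Rightarrow> complex) \<Rightarrow> complex \<Rightarrow> complex"
  where "phi_part a \<beta> \<gamma> q z = disc_power q (of_real a) z * deriv q z / (\<beta> * q z + \<gamma>)"

lemma S_fun_split:
  "S_fun \<alpha> \<beta> \<gamma> \<delta> \<mu> q z = theta_part (\<alpha> / \<mu>) \<delta> q z + z * phi_part (\<alpha> / \<mu>) \<beta> \<gamma> q z"
  by (simp add: S_fun_def theta_part_def phi_part_def)

locale starlike_pair =
  fixes G k :: "complex \<Rightarrow> complex"
  assumes G: "G holomorphic_on \<DD>" and k: "k holomorphic_on \<DD>"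
    and k_nz: "z \<in> \<DD> \<Longrightarrow> k z \<noteq> 0"
    and starlike: "z \<in> \<DD> \<Longrightarrow> Re (1 + z * deriv k z / k z) > 0"
    and accretive: "z \<in> \<DD> \<Longrightarrow> Re (deriv G z / k z) > 0"
begin

text \<open>Dividing the derivative of \<open>G + s * z * k\<close> by \<open>k\<close> gives
  \<open>G' / k + s * (1 + z * k' / k)\<close>, which still has positive real part. Hence
  \<open>close_to_convex_ray\<close> applies to every member of the chain.\<close>

lemma ray:
  assumes "s \<ge> 0" "t \<ge> 0" "u \<in> \<DD>" "norm z \<le> norm u" "z \<noteq> u"
  shows "G z + of_real s * (z * k z) \<noteq> G u + of_real (s + t) * (u * k u)"
proof -
  define f where "f = (\<lambda>z. G z + of_real s * (z * k z))"
  have "f z \<noteq> f u + of_real t * (u * k u)"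
  proof (rule close_to_convex_ray[OF k])
    show "f holomorphic_on \<DD>" unfolding f_def by (intro holomorphic_intros G k)
    fix x :: complex assume x: "x \<in> \<DD>"
    have d: "(G has_field_derivative deriv G x) (at x)" "(k has_field_derivative deriv k x) (at x)"
      using holomorphic_derivI[OF G open_ball x] holomorphic_derivI[OF k open_ball x] by auto
    have "(f has_field_derivative deriv G x + of_real s * (k x + x * deriv k x)) (at x)"
      unfolding f_def by (auto intro!: derivative_eq_intros d)
    then have "deriv f x / k x = deriv G x / k x + of_real s * (1 + x * deriv k x / k x)"
      using k_nz[OF x] by (simp add: DERIV_imp_deriv field_simps)
    then have "Re (deriv f x / k x) = Re (deriv G x / k x) + s * Re (1 + x * deriv k x / k x)"
      by (simp only: plus_complex.sel Re_complex_of_real times_complex.sel Im_complex_of_real)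
    moreover have "s * Re (1 + x * deriv k x / k x) \<ge> 0"
      using assms(1) starlike[OF x] by (intro mult_nonneg_nonneg) auto
    ultimately show "Re (deriv f x / k x) > 0" using accretive[OF x] by linarith
  qed (use assms k_nz starlike in auto)
  then show ?thesis by (simp add: f_def algebra_simps)
qed

lemma inj: "inj_on (\<lambda>z. G z + z * k z) \<DD>"
proof (rule inj_onI)
  have *: "x = y" if "G x + x * k x = G y + y * k y" "x \<in> \<DD>" "y \<in> \<DD>" "norm x \<le> norm y" for x y
    using ray[of 1 0 y x] that by auto
  show "x = y" if "x \<in> \<DD>" "y \<in> \<DD>" "G x + x * k x = G y + y * k y" for x y
    using *[of x y] *[of y x] that by (metis linear)
qed

text \<open>A point of the smaller image escaping from the larger one would, by connectedness, give a
  point of the former on a ray leaving the boundary of the latter.\<close>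
lemma shrink:
  assumes s: "0 \<le> s" "s \<le> 1" and z: "z \<in> \<DD>"
  obtains x where "norm x \<le> norm z" "G x + x * k x = G z + of_real s * (z * k z)"
proof (cases "z = 0")
  case True
  then show ?thesis using that[of 0] by simp
next
  case z0: False
  define L where "L = (\<lambda>(s::real) z. G z + of_real s * (z * k z))"
  define B where "B = ball (0::complex) (norm z)"
  have cB: "closure B = cball 0 (norm z)" unfolding B_def using z0 by (intro closure_ball) simp
  have sub: "cball 0 (norm z) \<subseteq> \<DD>" "B \<subseteq> \<DD>" using z by (auto simp: B_def)
  have Lh: "L s holomorphic_on \<DD>" for s unfolding L_def by (intro holomorphic_intros G k)
  have Lc: "continuous_on A (L s)" if "A \<subseteq> \<DD>" for A s
    using Lh that holomorphic_on_imp_continuous_on holomorphic_on_subset by blast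
  have "inj_on (L 1) B" using inj_on_subset[OF inj sub(2)] by (simp add: L_def)
  then have op: "open (L 1 ` B)"
    using open_mapping_thm3[of "L 1" B] holomorphic_on_subset[OF Lh sub(2)] by (simp add: B_def)
  have "closed (L 1 ` cball 0 (norm z))"
    by (intro compact_imp_closed compact_continuous_image Lc sub compact_cball)
  then have cl: "closure (L 1 ` B) \<subseteq> L 1 ` cball 0 (norm z)"
    by (intro closure_minimal) (auto simp: B_def)
  have "L s ` B \<subseteq> L 1 ` B"
  proof (rule ccontr)
    assume "\<not> ?thesis"
    then have "L s ` B - L 1 ` B \<noteq> {}" by blast
    moreover have "L s 0 \<in> L s ` B \<inter> L 1 ` B" using z0 by (auto simp: L_def B_def image_iff intro!: bexI[of _ 0])
    moreover have "connected (L s ` B)"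
      by (rule connected_continuous_image[OF Lc[OF sub(2)]]) (simp add: B_def)
    ultimately obtain c where c: "c \<in> L s ` B" "c \<in> frontier (L 1 ` B)"
      using connected_Int_frontier[of "L s ` B" "L 1 ` B"] by blast
    then obtain x u where x: "x \<in> B" "c = L s x" and u: "norm u \<le> norm z" "c = L 1 u" "c \<notin> L 1 ` B"
      using cl op by (auto simp: frontier_def interior_open)
    then have "norm u = norm z" by (force simp: B_def)
    then have "norm x \<le> norm u" "x \<noteq> u" "u \<in> \<DD>" using x(1) z by (auto simp: B_def)
    then have "L s x \<noteq> L 1 u"
      using ray[of s "1 - s" u x] s by (simp add: L_def)
    then show False using x u by simp
  qed
  \<comment> \<open>\<open>z\<close> lies on the boundary circle of \<open>B\<close>, so the
    inclusion has to pass to closures.\<close>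
  then have "L s ` closure B \<subseteq> closure (L 1 ` B)"
    using image_closure_subset[of B "L s" "closure (L 1 ` B)"] Lc[of "closure B"] cB sub closure_subset
    by (metis closed_closure subset_trans)
  moreover have "z \<in> closure B" unfolding cB by simp
  ultimately have "L s z \<in> L 1 ` cball 0 (norm z)" using cl by blast
  then show ?thesis using that by (auto simp: L_def)
qed

end

section \<open>Subordination and superordination\<close>

text \<open>This makes the multivalued powers of \<open>p\<close> and \<open>q\<close> agree at the point of contact.\<close>
lemma disc_log_branch:
  assumes p: "p \<in> class_R \<alpha> \<beta> \<gamma> \<delta> \<mu>" and q: "q \<in> class_R \<alpha> \<beta> \<gamma> \<delta> \<mu>" and z: "z \<in> \<DD>" "z \<noteq> 0"
    and v: "continuous_on (insert z (ball 0 (norm z))) v" "v ` insert z (ball 0 (norm z)) \<subseteq> \<DD>" "v 0 = 0"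
      "\<And>x. x \<in> insert z (ball 0 (norm z)) \<Longrightarrow> p x = q (v x)"
  shows "disc_log p z = disc_log q (v z)"
proof (rule exp_eq_on_connected[where S = "insert z (ball 0 (norm z))" and a = 0
      and f = "disc_log p" and g = "\<lambda>z. disc_log q (v z)"])
  have sub: "insert z (ball 0 (norm z)) \<subseteq> \<DD>" using z by auto
  show "connected (insert z (ball 0 (norm z)))"
    by (rule connected_intermediate_closure[of "ball 0 (norm z)"]) (use z in auto)
  show "continuous_on (insert z (ball 0 (norm z))) (disc_log p)"
    by (rule continuous_on_subset[OF holomorphic_on_imp_continuous_on[OF class_RD(7)[OF p]] sub])
  show "continuous_on (insert z (ball 0 (norm z))) (\<lambda>z. disc_log q (v z))"
    by (rule continuous_on_compose2[OF holomorphic_on_imp_continuous_on[OF class_RD(7)[OF q]] v(1,2)])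
  show "disc_log p 0 = disc_log q (v 0)" using class_RD(8)[OF p] class_RD(8)[OF q] v(3) by simp
  fix x assume x: "x \<in> insert z (ball 0 (norm z))"
  then have "x \<in> \<DD>" "v x \<in> \<DD>" using sub v(2) by blast+
  then show "exp (disc_log p x) = exp (disc_log q (v x))"
    using class_RD(9)[OF p] class_RD(9)[OF q] v(4)[OF x] by simp
qed (use z in auto)

text \<open>At the contact point the values and the logarithm branches agree, so the theta parts
  agree. The phi part is linear in the derivative and inherits the factor \<open>m\<close> from
  Jack's lemma. The superordination uses this with \<open>p\<close> and \<open>q\<close>
  exchanged.\<close>

lemma first_exit_parts:
  fixes p q :: "complex \<Rightarrow> complex"
  assumes p: "p \<in> class_R \<alpha> \<beta> \<gamma> \<delta> \<mu>" and q: "q \<in> class_R \<alpha> \<beta> \<gamma> \<delta> \<mu>" "univalent q" and n: "\<not> p \<prec> q"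
  obtains z u and m :: real where "u \<in> \<DD>" "norm z < norm u" "m \<ge> 1"
    "theta_part a \<delta> p z = theta_part a \<delta> q u"
    "z * phi_part a \<beta> \<gamma> p z = of_real m * (u * phi_part a \<beta> \<gamma> q u)"
proof -
  obtain z u v and m :: real where e: "u \<in> \<DD>" "norm z < norm u" "m \<ge> 1"
    "z * deriv p z = of_real m * (u * deriv q u)"
    "continuous_on (insert z (ball 0 (norm z))) v" "v ` insert z (ball 0 (norm z)) \<subseteq> \<DD>" "v 0 = 0" "v z = u"
    "\<And>x. x \<in> insert z (ball 0 (norm z)) \<Longrightarrow> p x = q (v x)" "z \<noteq> 0"
    using first_exit[OF class_RD(1)[OF p] q(2) _ n] class_RD(2)[OF p] class_RD(2)[OF q(1)] by metis
  have "disc_log p z = disc_log q u"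
    using disc_log_branch[OF p q(1) _ e(10) e(5,6,7,9)] e(1,2,8) by simp
  then have pw: "disc_power p c z = disc_power q c u" for c by (simp add: disc_power_def)
  have pz: "p z = q u" using e(8,9) by simp
  have "z * phi_part a \<beta> \<gamma> p z = disc_power q (of_real a) u * (z * deriv p z) / (\<beta> * q u + \<gamma>)"
    by (simp add: phi_part_def pw pz)
  also have "\<dots> = of_real m * (u * phi_part a \<beta> \<gamma> q u)" unfolding e(4) by (simp add: phi_part_def)
  finally show thesis using that[OF e(1-3)] by (simp add: theta_part_def pw)
qed

text \<open>With \<open>A = q^a\<close> and \<open>a = \<alpha> / \<mu>\<close>, the quotient
  \<open>G' / k\<close> is exactly the expression in \<open>acc\<close>. Since
  \<open>z * k = A * R\<close>, logarithmic differentiation turns the expression in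
  \<open>st\<close> into \<open>1 + z * k' / k\<close>.\<close>

lemma starlike_pair_parts:
  assumes q: "q \<in> class_R \<alpha> \<beta> \<gamma> \<delta> \<mu>" "univalent q"
    and acc: "\<And>z. z \<in> \<DD> \<Longrightarrow> Re ((\<beta> * q z + \<gamma>) * (1 + of_real (\<alpha> / \<mu>) + of_real \<alpha> * \<delta> / (of_real \<mu> * q z))) > 0"
    and st: "\<And>z. z \<in> \<DD> \<Longrightarrow> Re (of_real (\<alpha> / \<mu>) * (z * deriv q z / q z)
               + remove_sings (\<lambda>w. w * deriv (R_fun \<beta> \<gamma> q) w / R_fun \<beta> \<gamma> q w) z) > 0"
  shows "starlike_pair (theta_part (\<alpha> / \<mu>) \<delta> q) (phi_part (\<alpha> / \<mu>) \<beta> \<gamma> q)"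
proof
  define a where "a = \<alpha> / \<mu>"
  define l where "l = disc_log q"
  note R = class_RD[OF q(1)]
  have lh: "l holomorphic_on \<DD>" using R(7) by (simp add: l_def)
  have dq: "deriv q holomorphic_on \<DD>" by (intro holomorphic_deriv R(1)) simp
  have q': "deriv q z \<noteq> 0" if "z \<in> \<DD>" for z
    using holomorphic_injective_imp_regular[of q \<DD> z] q(2) that by (auto simp: univalent_def)
  have dl: "(l has_field_derivative deriv q z / q z) (at z)" if z: "z \<in> \<DD>" for z
    using holomorphic_derivI[OF lh open_ball z] deriv_logarithm[OF open_ball lh _ z, of q] R(9) by (simp add: l_def)
  have dpow: "(disc_power q c has_field_derivative disc_power q c z * (c * (deriv q z / q z))) (at z)"
    if z: "z \<in> \<DD>" for z c
    unfolding disc_power_def l_def[symmetric] by (auto intro!: derivative_eq_intros dl[OF z])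
  have hpow: "disc_power q c holomorphic_on \<DD>" for c
    unfolding disc_power_def l_def[symmetric] by (intro holomorphic_intros lh)
  have pow1: "disc_power q (of_real (a + 1)) z = disc_power q (of_real a) z * q z" if "z \<in> \<DD>" for z
    using R(9)[OF that] by (simp add: disc_power_def exp_add distrib_right)
  have pnz: "disc_power q c z \<noteq> 0" for c z by (simp add: disc_power_def)
  show "theta_part (\<alpha> / \<mu>) \<delta> q holomorphic_on \<DD>"
    unfolding theta_part_def by (intro holomorphic_intros hpow)
  show kh: "phi_part (\<alpha> / \<mu>) \<beta> \<gamma> q holomorphic_on \<DD>"
    unfolding phi_part_def by (intro holomorphic_intros hpow dq R(1) R(4))
  fix z :: complex assume z: "z \<in> \<DD>"
  show knz: "phi_part (\<alpha> / \<mu>) \<beta> \<gamma> q z \<noteq> 0"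
    using q'[OF z] R(4)[OF z] pnz by (simp add: phi_part_def)
  show "Re (deriv (theta_part (\<alpha> / \<mu>) \<delta> q) z / phi_part (\<alpha> / \<mu>) \<beta> \<gamma> q z) > 0"
  proof -
    define A where "A = disc_power q (of_real a) z"
    have A0: "A \<noteq> 0" using pnz by (simp add: A_def)
    have "(theta_part a \<delta> q has_field_derivative
        disc_power q (of_real (a + 1)) z * (of_real (a + 1) * (deriv q z / q z))
        + \<delta> * (disc_power q (of_real a) z * (of_real a * (deriv q z / q z)))) (at z)"
      unfolding theta_part_def by (intro DERIV_add DERIV_cmult dpow z)
    then have "deriv (theta_part a \<delta> q) z =
        A * q z * (of_real (a + 1) * (deriv q z / q z)) + \<delta> * (A * (of_real a * (deriv q z / q z)))"
      using pow1[OF z] by (simp add: DERIV_imp_deriv A_def)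
    also have "\<dots> = A * deriv q z * (1 + of_real a + of_real a * \<delta> / q z)"
      using R(3)[OF z] by (simp add: field_simps)
    also have "\<dots> / phi_part a \<beta> \<gamma> q z = (\<beta> * q z + \<gamma>) * (1 + of_real a + of_real a * \<delta> / q z)"
      using A0 q'[OF z] R(4)[OF z] by (simp add: phi_part_def A_def[symmetric])
    finally show ?thesis using acc[OF z] by (simp add: a_def)
  qed
  show "Re (1 + z * deriv (phi_part (\<alpha> / \<mu>) \<beta> \<gamma> q) z / phi_part (\<alpha> / \<mu>) \<beta> \<gamma> q z) > 0"
  \<comment> \<open>At 0 the expression equals 1. Elsewhere \<open>R\<close> is nonzero and
    \<open>remove_sings\<close> leaves the quotient unchanged.\<close>
  proof (cases "z = 0")
    case False
    define k R where "k = phi_part a \<beta> \<gamma> q" and "R = R_fun \<beta> \<gamma> q"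
    have kh': "k holomorphic_on \<DD>" using kh by (simp add: k_def a_def)
    have Rh: "R holomorphic_on \<DD>"
      unfolding R_def R_fun_def by (intro holomorphic_intros dq R(1) R(4))
    have R0: "R x \<noteq> 0" if "x \<in> \<DD>" "x \<noteq> 0" for x
      using that q' R(4) by (simp add: R_def R_fun_def)
    have "(\<lambda>w. w * deriv R w / R w) holomorphic_on (\<DD> - {0})"
      using R0 holomorphic_on_subset[OF Rh, of "\<DD> - {0}"]
        holomorphic_on_subset[OF holomorphic_deriv[OF Rh open_ball], of "\<DD> - {0}"]
      by (intro holomorphic_intros) auto
    then have "(\<lambda>w. w * deriv R w / R w) analytic_on {z}"
      using z False by (intro analytic_on_subset[of _ "\<DD> - {0}" "{z}"]) (auto simp: analytic_on_open open_delete)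
    then have rs: "remove_sings (\<lambda>w. w * deriv R w / R w) z = z * deriv R z / R z" by simp
    define A where "A = disc_power q (of_real a)"
    have AR: "A w * R w = w * k w" for w by (simp add: A_def R_def R_fun_def k_def phi_part_def)
    have "((\<lambda>w. A w * R w) has_field_derivative A z * (of_real a * (deriv q z / q z)) * R z + deriv R z * A z) (at z)"
      by (intro DERIV_mult holomorphic_derivI[OF Rh open_ball z]) (use dpow[OF z] in \<open>simp add: A_def\<close>)
    moreover have "((\<lambda>w. w * k w) has_field_derivative 1 * k z + deriv k z * z) (at z)"
      by (intro DERIV_mult DERIV_ident holomorphic_derivI[OF kh' open_ball z])
    ultimately have "A z * (of_real a * (deriv q z / q z)) * R z + deriv R z * A z = 1 * k z + deriv k z * z"
      unfolding AR by (rule DERIV_unique)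
    then have "z * (A z * (of_real a * (deriv q z / q z)) * R z + deriv R z * A z) / (A z * R z)
        = z * (1 * k z + deriv k z * z) / (z * k z)" by (simp add: AR)
    moreover have "A z \<noteq> 0" "R z \<noteq> 0" "k z \<noteq> 0" using pnz R0[OF z False] knz by (simp_all add: A_def k_def a_def)
    ultimately have "of_real a * (z * deriv q z / q z) + z * deriv R z / R z = 1 + z * deriv k z / k z"
      using False by (simp add: add_divide_distrib distrib_left mult.commute mult.left_commute)
    with st[OF z] rs have "Re (1 + z * deriv k z / k z) > 0" by (simp only: R_def a_def)
    then show ?thesis by (simp only: k_def a_def)
  qed simp
qed

lemma subordinate_of_S_fun:
  fixes p q w :: "complex \<Rightarrow> complex"
  assumes p: "p \<in> class_R \<alpha> \<beta> \<gamma> \<delta> \<mu>" and q: "q \<in> class_R \<alpha> \<beta> \<gamma> \<delta> \<mu>" "univalent q"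
    and sp: "starlike_pair (theta_part (\<alpha> / \<mu>) \<delta> q) (phi_part (\<alpha> / \<mu>) \<beta> \<gamma> q)"
    and w: "w holomorphic_on \<DD>" "w ` \<DD> \<subseteq> \<DD>" "w 0 = 0"
    and S: "\<And>z. z \<in> \<DD> \<Longrightarrow> S_fun \<alpha> \<beta> \<gamma> \<delta> \<mu> p z = S_fun \<alpha> \<beta> \<gamma> \<delta> \<mu> q (w z)"
  shows "p \<prec> q"
proof (rule ccontr)
  assume n: "\<not> p \<prec> q"
  define G k where "G = theta_part (\<alpha> / \<mu>) \<delta> q" and "k = phi_part (\<alpha> / \<mu>) \<beta> \<gamma> q"
  obtain z u and m :: real where e: "u \<in> \<DD>" "norm z < norm u" "m \<ge> 1"
    "theta_part (\<alpha> / \<mu>) \<delta> p z = G u" "z * phi_part (\<alpha> / \<mu>) \<beta> \<gamma> p z = of_real m * (u * k u)"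
    using first_exit_parts[OF p q n] unfolding G_def k_def by metis
  have "z \<in> \<DD>" using e by simp
  then have "norm (w z) \<le> norm z" using Schwarz_Lemma(1)[OF w(1,3)] w(2) by (auto simp: image_subset_iff)
  then have "norm (w z) \<le> norm u" "w z \<noteq> u" using e by auto
  \<comment> \<open>The chain parameter is 1 and the ray length is \<open>m - 1\<close>, which is
    nonnegative by Jack's lemma.\<close>
  then have "G (w z) + w z * k (w z) \<noteq> G u + of_real m * (u * k u)"
    using starlike_pair.ray[OF sp, of 1 "m - 1" u "w z"] e by (simp add: G_def k_def)
  then show False using S[OF \<open>z \<in> \<DD>\<close>] e(4,5) by (simp add: S_fun_split G_def k_def)
qed

lemma superordinate_of_S_fun:
  fixes p q w :: "complex \<Rightarrow> complex"
  assumes p: "p \<in> class_R \<alpha> \<beta> \<gamma> \<delta> \<mu>" "univalent p" and q: "q \<in> class_R \<alpha> \<beta> \<gamma> \<delta> \<mu>"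
    and sp: "starlike_pair (theta_part (\<alpha> / \<mu>) \<delta> q) (phi_part (\<alpha> / \<mu>) \<beta> \<gamma> q)"
    and inj: "inj_on (S_fun \<alpha> \<beta> \<gamma> \<delta> \<mu> p) \<DD>"
    and w: "w holomorphic_on \<DD>" "w ` \<DD> \<subseteq> \<DD>" "w 0 = 0"
    and S: "\<And>z. z \<in> \<DD> \<Longrightarrow> S_fun \<alpha> \<beta> \<gamma> \<delta> \<mu> q z = S_fun \<alpha> \<beta> \<gamma> \<delta> \<mu> p (w z)"
  shows "q \<prec> p"
proof (rule ccontr)
  assume n: "\<not> q \<prec> p"
  define G k where "G = theta_part (\<alpha> / \<mu>) \<delta> q" and "k = phi_part (\<alpha> / \<mu>) \<beta> \<gamma> q"
  obtain z u and m :: real where e: "u \<in> \<DD>" "norm z < norm u" "m \<ge> 1"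
    "G z = theta_part (\<alpha> / \<mu>) \<delta> p u" "z * k z = of_real m * (u * phi_part (\<alpha> / \<mu>) \<beta> \<gamma> p u)"
    using first_exit_parts[OF q p n] unfolding G_def k_def by metis
  have zD: "z \<in> \<DD>" using e by simp
  \<comment> \<open>The factor \<open>1 / m\<close> undoes Jack's multiplier, so the right-hand side
    is \<open>S_fun\<close> of \<open>p\<close> at \<open>u\<close>. The same value is taken at
    \<open>w x\<close>, which is strictly smaller in modulus than \<open>u\<close>.\<close>
  obtain x where x: "norm x \<le> norm z" "G x + x * k x = G z + of_real (1 / m) * (z * k z)"
    using starlike_pair.shrink[OF sp, of "1 / m" z] e(3) zD unfolding G_def k_def by auto
  have xD: "x \<in> \<DD>" using x zD by simp
  then have "norm (w x) \<le> norm x" using Schwarz_Lemma(1)[OF w(1,3)] w(2) by (auto simp: image_subset_iff)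
  then have wx: "norm (w x) < norm u" using x e by simp
  have "S_fun \<alpha> \<beta> \<gamma> \<delta> \<mu> p (w x) = G x + x * k x"
    using S[OF xD] by (simp add: S_fun_split G_def k_def)
  also have "\<dots> = S_fun \<alpha> \<beta> \<gamma> \<delta> \<mu> p u"
    using x(2) e(3,4,5) by (simp add: S_fun_split)
  finally have "w x = u" using inj_onD[OF inj] w(2) xD e(1) by blast
  then show False using wx by simp
qed

theorem theorem2p5:
  fixes \<alpha> \<mu> :: real and \<beta> \<gamma> \<delta> :: complex and q\<^sub>1 q\<^sub>2 :: "complex \<Rightarrow> complex"
  assumes "0 < \<mu>" and "\<mu> \<le> 1" and "\<alpha> + \<mu> \<ge> 0" and "\<beta> \<noteq> 0"
    and "\<forall>q \<in> {q\<^sub>1, q\<^sub>2}. q \<in> class_R \<alpha> \<beta> \<gamma> \<delta> \<mu> \<and> univalent q"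
    and "\<forall>q \<in> {q\<^sub>1, q\<^sub>2}. \<forall>z\<in>\<DD>.
           Re ((\<beta> * q z + \<gamma>) * (1 + of_real (\<alpha> / \<mu>) + of_real \<alpha> * \<delta> / (of_real \<mu> * q z))) > 0"
    and "\<forall>q \<in> {q\<^sub>1, q\<^sub>2}. \<forall>z\<in>\<DD>.
           Re (of_real (\<alpha> / \<mu>) * (z * deriv q z / q z)
               + remove_sings (\<lambda>w. w * deriv (R_fun \<beta> \<gamma> q) w / R_fun \<beta> \<gamma> q w) z) > 0"
  shows "(\<forall>p \<in> class_R \<alpha> \<beta> \<gamma> \<delta> \<mu>.
            p holomorphic_on \<DD> \<and> p \<in> class_Q \<and> univalent (S_fun \<alpha> \<beta> \<gamma> \<delta> \<mu> p) \<and>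
            P_fun \<alpha> \<beta> \<gamma> \<delta> \<mu> q\<^sub>1 \<prec> P_fun \<alpha> \<beta> \<gamma> \<delta> \<mu> p \<and>
            P_fun \<alpha> \<beta> \<gamma> \<delta> \<mu> p \<prec> P_fun \<alpha> \<beta> \<gamma> \<delta> \<mu> q\<^sub>2
            \<longrightarrow> q\<^sub>1 \<prec> p \<and> p \<prec> q\<^sub>2)
       \<and> best_subordinant \<alpha> \<beta> \<gamma> \<delta> \<mu> (P_fun \<alpha> \<beta> \<gamma> \<delta> \<mu> q\<^sub>1) q\<^sub>1
       \<and> best_dominant \<alpha> \<beta> \<gamma> \<delta> \<mu> (P_fun \<alpha> \<beta> \<gamma> \<delta> \<mu> q\<^sub>2) q\<^sub>2"
proof -
  have q1: "q\<^sub>1 \<in> class_R \<alpha> \<beta> \<gamma> \<delta> \<mu>" "univalent q\<^sub>1" and q2: "q\<^sub>2 \<in> class_R \<alpha> \<beta> \<gamma> \<delta> \<mu>" "univalent q\<^sub>2"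
    using assms(5) by auto
  have sp1: "starlike_pair (theta_part (\<alpha> / \<mu>) \<delta> q\<^sub>1) (phi_part (\<alpha> / \<mu>) \<beta> \<gamma> q\<^sub>1)"
    by (rule starlike_pair_parts[OF q1]) (use assms(6,7) in auto)
  have sp2: "starlike_pair (theta_part (\<alpha> / \<mu>) \<delta> q\<^sub>2) (phi_part (\<alpha> / \<mu>) \<beta> \<gamma> q\<^sub>2)"
    by (rule starlike_pair_parts[OF q2]) (use assms(6,7) in auto)
  have dom: "p \<prec> q\<^sub>2" if p: "p \<in> class_R \<alpha> \<beta> \<gamma> \<delta> \<mu>" and P: "P_fun \<alpha> \<beta> \<gamma> \<delta> \<mu> p \<prec> P_fun \<alpha> \<beta> \<gamma> \<delta> \<mu> q\<^sub>2" for p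
  proof -
    obtain w where w: "w holomorphic_on \<DD>" "w ` \<DD> \<subseteq> \<DD>" "w 0 = 0"
      and wP: "\<And>z. z \<in> \<DD> \<Longrightarrow> P_fun \<alpha> \<beta> \<gamma> \<delta> \<mu> p z = P_fun \<alpha> \<beta> \<gamma> \<delta> \<mu> q\<^sub>2 (w z)"
      using P unfolding subordinate_def by blast
    show ?thesis
      by (rule subordinate_of_S_fun[OF p q2 sp2 w S_fun_factor[OF p q2(1) assms(1,2) w wP]])
  qed
  have sub: "q\<^sub>1 \<prec> p" if p: "p \<in> class_R \<alpha> \<beta> \<gamma> \<delta> \<mu>" "univalent p" "univalent (S_fun \<alpha> \<beta> \<gamma> \<delta> \<mu> p)"
    and P: "P_fun \<alpha> \<beta> \<gamma> \<delta> \<mu> q\<^sub>1 \<prec> P_fun \<alpha> \<beta> \<gamma> \<delta> \<mu> p" for p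
  proof -
    obtain w where w: "w holomorphic_on \<DD>" "w ` \<DD> \<subseteq> \<DD>" "w 0 = 0"
      and wP: "\<And>z. z \<in> \<DD> \<Longrightarrow> P_fun \<alpha> \<beta> \<gamma> \<delta> \<mu> q\<^sub>1 z = P_fun \<alpha> \<beta> \<gamma> \<delta> \<mu> p (w z)"
      using P unfolding subordinate_def by blast
    have "inj_on (S_fun \<alpha> \<beta> \<gamma> \<delta> \<mu> p) \<DD>" using p(3) by (simp add: univalent_def)
    then show ?thesis
      by (rule superordinate_of_S_fun[OF p(1,2) q1(1) sp1 _ w S_fun_factor[OF q1(1) p(1) assms(1,2) w wP]])
  qed
  have refl: "P_fun \<alpha> \<beta> \<gamma> \<delta> \<mu> q \<prec> P_fun \<alpha> \<beta> \<gamma> \<delta> \<mu> q" if "q \<in> class_R \<alpha> \<beta> \<gamma> \<delta> \<mu>" for q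
  proof -
    have "P_fun \<alpha> \<beta> \<gamma> \<delta> \<mu> q holomorphic_on \<DD>"
      unfolding P_fun_def by (intro holomorphic_on_mult class_RD(5,6)[OF that])
    then show ?thesis unfolding subordinate_def
      by (intro conjI exI[of _ "\<lambda>z. z"]) (auto intro: holomorphic_intros)
  qed
  have "univalent (S_fun \<alpha> \<beta> \<gamma> \<delta> \<mu> q\<^sub>1)"
  proof -
    have "S_fun \<alpha> \<beta> \<gamma> \<delta> \<mu> q\<^sub>1 = (\<lambda>z. theta_part (\<alpha> / \<mu>) \<delta> q\<^sub>1 z + z * phi_part (\<alpha> / \<mu>) \<beta> \<gamma> q\<^sub>1 z)"
      by (rule ext) (rule S_fun_split)
    then show ?thesis using starlike_pair.inj[OF sp1] starlike_pair.G[OF sp1] starlike_pair.k[OF sp1]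
      unfolding univalent_def by (auto intro!: holomorphic_intros)
  qed
  \<comment> \<open>\<open>q\<^sub>1\<close> is itself a solution, so every subordinant is
    subordinate to it.\<close>
  then have sol: "superordination_solution \<alpha> \<beta> \<gamma> \<delta> \<mu> (P_fun \<alpha> \<beta> \<gamma> \<delta> \<mu> q\<^sub>1) q\<^sub>1"
    using q1 refl by (simp add: superordination_solution_def)
  have "univalent p" if "p \<in> class_R \<alpha> \<beta> \<gamma> \<delta> \<mu>" "p \<in> class_Q" for p
  proof -
    have "\<DD> \<subseteq> cball 0 1 - exceptional_set p" by (auto simp: exceptional_set_def)
    then show ?thesis using that class_RD(1)[OF that(1)]
      by (auto simp: univalent_def class_Q_def intro: inj_on_subset)
  qed
  then have "\<forall>p \<in> class_R \<alpha> \<beta> \<gamma> \<delta> \<mu>.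
            p holomorphic_on \<DD> \<and> p \<in> class_Q \<and> univalent (S_fun \<alpha> \<beta> \<gamma> \<delta> \<mu> p) \<and>
            P_fun \<alpha> \<beta> \<gamma> \<delta> \<mu> q\<^sub>1 \<prec> P_fun \<alpha> \<beta> \<gamma> \<delta> \<mu> p \<and>
            P_fun \<alpha> \<beta> \<gamma> \<delta> \<mu> p \<prec> P_fun \<alpha> \<beta> \<gamma> \<delta> \<mu> q\<^sub>2
            \<longrightarrow> q\<^sub>1 \<prec> p \<and> p \<prec> q\<^sub>2" using sub dom by blast
  moreover have "best_subordinant \<alpha> \<beta> \<gamma> \<delta> \<mu> (P_fun \<alpha> \<beta> \<gamma> \<delta> \<mu> q\<^sub>1) q\<^sub>1"
    using q1 sub sol class_RD(1)[OF q1(1)]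
    by (auto simp: best_subordinant_def subordinant_def superordination_solution_def)
  \<comment> \<open>By reflexivity \<open>q\<^sub>2\<close> satisfies the subordination, so it is
    subordinate to every dominant.\<close>
  moreover have "best_dominant \<alpha> \<beta> \<gamma> \<delta> \<mu> (P_fun \<alpha> \<beta> \<gamma> \<delta> \<mu> q\<^sub>2) q\<^sub>2"
    using q2 dom refl by (auto simp: best_dominant_def dominant_def)
  ultimately show ?thesis by blast
qed

end
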